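(* Let $\mathcal A=\mathbb T^2_\theta$ ($\theta$ irrational) be the noncommutative 2-torus, regarded as a quantum principal $U(1)$-bundle over $\mathcal B=C^\infty(S^1)$ via $\delta_2$, with flat Dirac operator $D=\sigma^1\delta_1+\sigma^2\delta_2$. Let $\omega=\sigma^2+\sigma^1\omega_1$, with $\omega_1=\omega_1^*\in\mathcal B$, be a selfadjoint strong connection. Then the Dirac operator $$D^{(\omega)}=D-\sigma^1j_0\omega_1j_0^{-1}\delta_2,\qquad j_0=\gamma J,$$ is compatible with $\omega$.
   Context: $\mathcal A=\mathbb T^2_\theta$ is the smooth algebra of the noncommutative 2-torus with unitary generators $U,V$, $UV=e^{2\pi i\theta}VU$. The derivations satisfy $\delta_1(U)=U$, $\delta_1(V)=0$, $\delta_2(U)=0$, $\delta_2(V)=V$. The $U(1)$-action is generated by $\delta=\delta_2$; $\mathcal A^{(k)}=\{a:\delta_2(a)=ka\}$ and $\mathcal B=\mathcal A^{(0)}$ is the (commutative) smooth algebra generated by $U$. $\mathcal H=\mathcal H_\tau\otimes\mathbb C^2$, $\mathcal H_\tau$ the GNS space of the unique tracial state; $\mathcal A$ acts on the first factor, and $\delta_1,\delta_2$ also denote the selfadjoint operators on $\mathcal H$ (integer spectrum, killing the cyclic vector) implementing the derivations. $\mathcal H_k$ is the $k$-eigenspace of $\delta_2$. $\sigma^i$ are the Pauli matrices acting on $\mathbb C^2$; $\gamma=\mathrm{id}\otimes\sigma^3$; $J=J_0\otimes(i\sigma^2\circ c.c.)$ with $J_0$ the Tomita–Takesaki antiunitary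 involution on $\mathcal H_\tau$ and $c.c.$ complex conjugation; $\Gamma=\mathrm{id}\otimes\sigma^2$. The horizontal part of an operator $D'$ is $D'_h=\frac12\Gamma[\Gamma,D']$; in particular $D_h=\sigma^1\delta_1$. $\Omega^1_D(\mathcal A)$ (resp. $\Omega^1_D(\mathcal B)$) is the span of $a'[D,a]$ with $a,a'\in\mathcal A$ (resp. $\mathcal B$). A strong connection is $\omega\in\Omega^1_D(\mathcal A)$ with $[\delta_2,\omega]=0$; $\sum_ip_i\delta_2(q_i)=1$ whenever $\omega=\sum_ip_i[D,q_i]$; and $\nabla_\omega(a):=[D,a]-\delta_2(a)\omega\in\Omega^1_D(\mathcal B)\mathcal A$ for all $a\in\mathcal A$. Right actions: $ha:=Ja^*J^{-1}h$; for $b,b'\in\mathcal B$, $h(b'[D,b]):=[D,Jb^*J^{-1}](hb')$ (so $h\eta=-J\eta^*J^{-1}h$ for $\eta\in\Omega^1_D(\mathcal B)$), and $h(\eta a)=(h\eta)a$. The twisted Dirac operator $D_\omega$ is determined on the span of the vectors $ha$ ($h\in\mathcal H_0$ in the domain of $D_h$, $a\in\mathcal A^{(k)}$, $k\in\mathbb Z$) by $D_\omega(ha)=(D_hh)a+h\nabla_\omega(a)$. A Dirac operator $D'$ on $\mathcal H$ (having the same restriction of its horizontal part to $\mathcal H_0$ as $D$) is compatible with $\omega$ if $D_\omega$ and $D'_h$ coincide on a dense subset of $\mathcal H$. *)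

theory Defs
  imports "HOL-Analysis.Analysis" "HOL-Library.Function_Algebras"
begin

text \<open>
  An element \<open>\<Sum> a(m,n) U\<^sup>m V\<^sup>n\<close> of the smooth algebra is represented by its family of Fourier
  coefficients. Sums and differences of families (and of vectors below) are pointwise.
  The product and the involution come from \<open>U V = e(\<theta>) V U\<close>, with \<open>e(x) = exp (2 \<pi> i x)\<close>:
  \<open>(U\<^sup>p V\<^sup>q) (U\<^sup>r V\<^sup>s) = e(- \<theta> q r) U\<^sup>p\<^sup>+\<^sup>r V\<^sup>q\<^sup>+\<^sup>s\<close> and
  \<open>(U\<^sup>m V\<^sup>n)\<^sup>* = e(- \<theta> m n) U\<^sup>-\<^sup>m V\<^sup>-\<^sup>n\<close>.
\<close>

type_synonym coeffs = "int \<times> int \<Rightarrow> complex"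

definition smooth :: "coeffs set" where
  "smooth = {a. \<forall>k::nat. \<exists>C. \<forall>m n. (1 + \<bar>real_of_int m\<bar> + \<bar>real_of_int n\<bar>) ^ k * cmod (a (m, n)) \<le> C}"

definition phase :: "real \<Rightarrow> int \<Rightarrow> complex" where
  "phase \<theta> j = cis (2 * pi * \<theta> * real_of_int j)"

definition mult :: "real \<Rightarrow> coeffs \<Rightarrow> coeffs \<Rightarrow> coeffs" where
  "mult \<theta> a b = (\<lambda>(m, n). \<Sum>\<^sub>\<infinity>(p, q)\<in>UNIV. phase \<theta> (- (q * (m - p))) * a (p, q) * b (m - p, n - q))"

definition star :: "real \<Rightarrow> coeffs \<Rightarrow> coeffs" where
  "star \<theta> a = (\<lambda>(m, n). phase \<theta> (- (m * n)) * cnj (a (- m, - n)))"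

definition monomial :: "int \<Rightarrow> int \<Rightarrow> coeffs" where
  "monomial m n = (\<lambda>x. if x = (m, n) then 1 else 0)"

abbreviation "U_gen \<equiv> monomial 1 0"
abbreviation "V_gen \<equiv> monomial 0 1"
abbreviation "one_alg \<equiv> monomial 0 0"

definition tau :: "coeffs \<Rightarrow> complex" where
  "tau a = a (0, 0)"

definition der1 :: "coeffs \<Rightarrow> coeffs" where
  "der1 a = (\<lambda>(m, n). of_int m * a (m, n))"

definition der2 :: "coeffs \<Rightarrow> coeffs" where
  "der2 a = (\<lambda>(m, n). of_int n * a (m, n))"

definition alg_weight :: "int \<Rightarrow> coeffs set" where
  "alg_weight k = {a \<in> smooth. der2 a = (\<lambda>x. of_int k * a x)}"

definition base :: "coeffs set" where
  "base = alg_weight 0"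

text \<open>
  The GNS space of the trace \<open>tau\<close> is \<open>\<ell>\<^sup>2(\<int> \<times> \<int>)\<close>, an algebra element being sent to its family of
  coefficients (lemma \<open>tau_star_mult\<close> below), so that \<open>H\<^sub>\<tau> \<otimes> \<complex>\<^sup>2\<close> consists of the square
  summable families with values in \<open>\<complex>\<^sup>2\<close>. All operators, also the unbounded ones, are given by
  formulas on arbitrary families; only their restrictions to the relevant subspaces of
  \<open>hilb\<close> matter, and domains are always specified separately.
\<close>

type_synonym spinor = "int \<times> int \<Rightarrow> complex ^ 2"
type_synonym oper = "spinor \<Rightarrow> spinor"

definition hilb :: "spinor set" where
  "hilb = {\<psi>. (\<lambda>x. (norm (\<psi> x))\<^sup>2) summable_on UNIV}"

definition hnorm :: "spinor \<Rightarrow> real" where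
  "hnorm \<psi> = sqrt (\<Sum>\<^sub>\<infinity>x\<in>UNIV. (norm (\<psi> x))\<^sup>2)"

definition hinner :: "spinor \<Rightarrow> spinor \<Rightarrow> complex" where
  "hinner \<phi> \<psi> = (\<Sum>\<^sub>\<infinity>x\<in>UNIV. \<Sum>i\<in>UNIV. cnj (\<phi> x $ i) * \<psi> x $ i)"

definition dense_in_hilb :: "spinor set \<Rightarrow> bool" where
  "dense_in_hilb S \<longleftrightarrow> S \<subseteq> hilb \<and> (\<forall>\<psi>\<in>hilb. \<forall>\<epsilon>>0. \<exists>\<phi>\<in>S. hnorm (\<psi> - \<phi>) < \<epsilon>)"

definition scale :: "complex \<Rightarrow> oper" where
  "scale c \<psi> = (\<lambda>x. c *s \<psi> x)"

definition spin :: "complex ^ 2 ^ 2 \<Rightarrow> oper" where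
  "spin M \<psi> = (\<lambda>x. M *v \<psi> x)"

definition pauli1 :: "complex ^ 2 ^ 2" where
  "pauli1 = vector [vector [0, 1], vector [1, 0]]"

definition pauli2 :: "complex ^ 2 ^ 2" where
  "pauli2 = vector [vector [0, - \<i>], vector [\<i>, 0]]"

definition pauli3 :: "complex ^ 2 ^ 2" where
  "pauli3 = vector [vector [1, 0], vector [0, - 1]]"

abbreviation "\<sigma>1 \<equiv> spin pauli1"
abbreviation "\<sigma>2 \<equiv> spin pauli2"
abbreviation "\<gamma> \<equiv> spin pauli3"
abbreviation "\<Gamma> \<equiv> spin pauli2"

definition \<delta>1 :: oper where
  "\<delta>1 \<psi> = (\<lambda>(m, n). of_int m *s \<psi> (m, n))"

definition \<delta>2 :: oper where
  "\<delta>2 \<psi> = (\<lambda>(m, n). of_int n *s \<psi> (m, n))"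

definition dom_\<delta>2 :: "spinor set" where
  "dom_\<delta>2 = {\<psi> \<in> hilb. \<delta>2 \<psi> \<in> hilb}"

definition hilb_weight :: "int \<Rightarrow> spinor set" where
  "hilb_weight k = {\<psi> \<in> hilb. \<delta>2 \<psi> = scale (of_int k) \<psi>}"

definition lact :: "real \<Rightarrow> coeffs \<Rightarrow> oper" where
  "lact \<theta> a \<psi> = (\<lambda>(m, n). \<Sum>\<^sub>\<infinity>(p, q)\<in>UNIV. (phase \<theta> (- (q * (m - p))) * a (p, q)) *s \<psi> (m - p, n - q))"

text \<open>The first tensor factor of \<open>J\<close> is the (antilinear) extension of \<open>star\<close> to the GNS space,
  the second one is \<open>v \<mapsto> i \<sigma>\<^sup>2 v\<^sup>c\<close>. Both \<open>J\<close> and \<open>j0\<close> are bijective on all families, so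
  that \<open>inv\<close> gives their inverses.\<close>

definition J :: "real \<Rightarrow> oper" where
  "J \<theta> \<psi> = (\<lambda>(m, n). phase \<theta> (- (m * n)) *s (\<i> *s (pauli2 *v (\<chi> i. cnj (\<psi> (- m, - n) $ i)))))"

definition j0 :: "real \<Rightarrow> oper" where
  "j0 \<theta> = \<gamma> \<circ> J \<theta>"

definition ract :: "real \<Rightarrow> coeffs \<Rightarrow> oper" where
  "ract \<theta> a \<psi> = J \<theta> (lact \<theta> (star \<theta> a) (inv (J \<theta>) \<psi>))"

definition comm :: "oper \<Rightarrow> oper \<Rightarrow> oper" where
  "comm S T \<psi> = S (T \<psi>) - T (S \<psi>)"

definition dirac :: oper where
  "dirac \<psi> = \<sigma>1 (\<delta>1 \<psi>) + \<sigma>2 (\<delta>2 \<psi>)"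

definition dom_dirac :: "spinor set" where
  "dom_dirac = {\<psi> \<in> hilb. \<delta>1 \<psi> \<in> hilb \<and> \<delta>2 \<psi> \<in> hilb}"

definition eq_on_hilb :: "oper \<Rightarrow> oper \<Rightarrow> bool" where
  "eq_on_hilb S T \<longleftrightarrow> (\<forall>\<psi>\<in>hilb. S \<psi> = T \<psi>)"

text \<open>
  A list of pairs \<open>(p, q)\<close> stands for \<open>\<Sum> p [D, q]\<close>. For smooth \<open>q\<close>, the series defining the
  commutator on an arbitrary vector of \<open>hilb\<close> converge and yield the bounded extension of
  \<open>[D, q]\<close> from \<open>dom_dirac\<close> (lemma \<open>comm_dirac_lact\<close> below).
  Complex coefficients of a linear combination can be absorbed in \<open>p\<close>.
\<close>

definition form_op :: "real \<Rightarrow> (coeffs \<times> coeffs) list \<Rightarrow> oper" where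
  "form_op \<theta> ps \<psi> = (\<Sum>(p, q)\<leftarrow>ps. lact \<theta> p (comm dirac (lact \<theta> q) \<psi>))"

definition one_forms :: "real \<Rightarrow> coeffs set \<Rightarrow> oper set" where
  "one_forms \<theta> S = {\<eta>. \<exists>ps. set ps \<subseteq> S \<times> S \<and> eq_on_hilb \<eta> (form_op \<theta> ps)}"

text \<open>A list of triples \<open>(b', b, a)\<close> stands for the element \<open>\<Sum> b' [D, b] a\<close> of
  \<open>\<Omega>\<^sup>1\<^sub>D(B) A\<close>.\<close>

definition form_alg_op :: "real \<Rightarrow> (coeffs \<times> coeffs \<times> coeffs) list \<Rightarrow> oper" where
  "form_alg_op \<theta> ts \<psi> = (\<Sum>(b', b, a)\<leftarrow>ts. lact \<theta> b' (comm dirac (lact \<theta> b) (lact \<theta> a \<psi>)))"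

definition base_forms_alg :: "real \<Rightarrow> oper set" where
  "base_forms_alg \<theta> =
     {\<eta>. \<exists>ts. set ts \<subseteq> base \<times> base \<times> smooth \<and> eq_on_hilb \<eta> (form_alg_op \<theta> ts)}"

definition nabla :: "real \<Rightarrow> oper \<Rightarrow> coeffs \<Rightarrow> oper" where
  "nabla \<theta> \<omega> a \<psi> = comm dirac (lact \<theta> a) \<psi> - lact \<theta> (der2 a) (\<omega> \<psi>)"

definition strong_connection :: "real \<Rightarrow> oper \<Rightarrow> bool" where
  "strong_connection \<theta> \<omega> \<longleftrightarrow>
     \<omega> \<in> one_forms \<theta> smooth \<and>
     (\<forall>\<psi>\<in>dom_\<delta>2. comm \<delta>2 \<omega> \<psi> = 0) \<and>
     (\<forall>ps. set ps \<subseteq> smooth \<times> smooth \<and> eq_on_hilb \<omega> (form_op \<theta> ps) \<longrightarrow>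
        (\<Sum>(p, q)\<leftarrow>ps. mult \<theta> p (der2 q)) = one_alg) \<and>
     (\<forall>a\<in>smooth. nabla \<theta> \<omega> a \<in> base_forms_alg \<theta>)"

definition op_graph :: "spinor set \<Rightarrow> oper \<Rightarrow> (spinor \<times> spinor) set" where
  "op_graph dm T = {(\<psi>, T \<psi>) |\<psi>. \<psi> \<in> dm}"

definition adjoint_graph :: "spinor set \<Rightarrow> oper \<Rightarrow> (spinor \<times> spinor) set" where
  "adjoint_graph dm T =
     {(\<phi>, \<eta>). \<phi> \<in> hilb \<and> \<eta> \<in> hilb \<and> (\<forall>\<psi>\<in>dm. hinner \<phi> (T \<psi>) = hinner \<eta> \<psi>)}"

definition selfadjoint_op :: "spinor set \<Rightarrow> oper \<Rightarrow> bool" where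
  "selfadjoint_op dm T \<longleftrightarrow> dense_in_hilb dm \<and> adjoint_graph dm T = op_graph dm T"

definition bounded_commutators :: "real \<Rightarrow> spinor set \<Rightarrow> oper \<Rightarrow> bool" where
  "bounded_commutators \<theta> dm T \<longleftrightarrow>
     (\<forall>a\<in>smooth. (\<forall>\<psi>\<in>dm. lact \<theta> a \<psi> \<in> dm) \<and>
        (\<exists>C. \<forall>\<psi>\<in>dm. hnorm (comm T (lact \<theta> a) \<psi>) \<le> C * hnorm \<psi>))"

text \<open>For selfadjoint \<open>T\<close> and non-real \<open>z\<close> the map \<open>T - z\<close> is a bijection from the domain onto
  \<open>hilb\<close>, and the vectors \<open>X n\<close> below are the images under the resolvent of arbitrary vectors in
  the closed unit ball.\<close>

definition compact_resolvent :: "spinor set \<Rightarrow> oper \<Rightarrow> bool" where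
  "compact_resolvent dm T \<longleftrightarrow>
     (\<forall>z. Im z \<noteq> 0 \<longrightarrow>
        (\<forall>X :: nat \<Rightarrow> spinor. (\<forall>n. X n \<in> dm \<and> hnorm (T (X n) - scale z (X n)) \<le> 1) \<longrightarrow>
           (\<exists>\<psi>\<in>hilb. \<exists>r. strict_mono r \<and> (\<lambda>n. hnorm (X (r n) - \<psi>)) \<longlonglongrightarrow> 0)))"

text \<open>The operator of a spectral triple over the smooth algebra acting by \<open>lact\<close>.\<close>

definition dirac_operator :: "real \<Rightarrow> spinor set \<Rightarrow> oper \<Rightarrow> bool" where
  "dirac_operator \<theta> dm T \<longleftrightarrow>
     selfadjoint_op dm T \<and> bounded_commutators \<theta> dm T \<and> compact_resolvent dm T"

definition horizontal :: "oper \<Rightarrow> oper" where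
  "horizontal T \<psi> = scale (1 / 2) (\<Gamma> (comm \<Gamma> T \<psi>))"

definition horizontal_dom :: "spinor set \<Rightarrow> spinor set" where
  "horizontal_dom dm = {\<psi> \<in> dm. \<Gamma> \<psi> \<in> dm}"

text \<open>
  \<open>right_form_op \<theta> ts h\<close> is \<open>h (\<Sum> b' [D, b] a)\<close>, where \<open>h (b' [D, b]) = [D, J b\<^sup>* J\<^sup>-\<^sup>1] (h b')\<close>
  and \<open>h (\<eta> a) = (h \<eta>) a\<close>.
\<close>

definition right_form_op :: "real \<Rightarrow> (coeffs \<times> coeffs \<times> coeffs) list \<Rightarrow> oper" where
  "right_form_op \<theta> ts h = (\<Sum>(b', b, a)\<leftarrow>ts. ract \<theta> a (comm dirac (ract \<theta> b) (ract \<theta> b' h)))"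

text \<open>
  The graph of \<open>D\<^sub>\<omega>\<close> on the span of the vectors \<open>h a\<close>. It is built from all presentations of a
  vector as a sum of vectors \<open>h a\<close> and of \<open>\<nabla>\<^sub>\<omega> a\<close> as an element of \<open>\<Omega>\<^sup>1\<^sub>D(B) A\<close>; that the
  result does not depend on them is not built in, but is part of \<open>compatible\<close> below.
\<close>

inductive_set twisted_dirac :: "real \<Rightarrow> oper \<Rightarrow> (spinor \<times> spinor) set"
  for \<theta> :: real and \<omega> :: oper where
  zero: "(0, 0) \<in> twisted_dirac \<theta> \<omega>"
| add: "(\<psi> + ract \<theta> a h, \<xi> + (ract \<theta> a (horizontal dirac h) + right_form_op \<theta> ts h)) \<in> twisted_dirac \<theta> \<omega>"
    if "(\<psi>, \<xi>) \<in> twisted_dirac \<theta> \<omega>"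
       "h \<in> hilb_weight 0 \<inter> horizontal_dom dom_dirac" "a \<in> alg_weight k"
       "set ts \<subseteq> base \<times> base \<times> smooth" "eq_on_hilb (nabla \<theta> \<omega> a) (form_alg_op \<theta> ts)"

definition compatible :: "real \<Rightarrow> oper \<Rightarrow> spinor set \<Rightarrow> oper \<Rightarrow> bool" where
  "compatible \<theta> \<omega> dm D' \<longleftrightarrow>
     dirac_operator \<theta> dm D' \<and>
     hilb_weight 0 \<inter> horizontal_dom dm = hilb_weight 0 \<inter> horizontal_dom dom_dirac \<and>
     (\<forall>h \<in> hilb_weight 0 \<inter> horizontal_dom dm. horizontal D' h = horizontal dirac h) \<and>
     (\<exists>S. dense_in_hilb S \<and> S \<subseteq> horizontal_dom dm \<and>
        (\<forall>\<psi>\<in>S. \<forall>\<xi>. (\<psi>, \<xi>) \<in> twisted_dirac \<theta> \<omega> \<longleftrightarrow> \<xi> = horizontal D' \<psi>))"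

lemma tau_star_mult:
  "tau (mult \<theta> (star \<theta> a) b) = (\<Sum>\<^sub>\<infinity>x\<in>UNIV. cnj (a x) * b x)"
proof -
  have "tau (mult \<theta> (star \<theta> a) b) = (\<Sum>\<^sub>\<infinity>x\<in>UNIV. cnj (a (- x)) * b (- x))"
    unfolding tau_def mult_def star_def phase_def
    by (auto intro!: infsum_cong simp: cis_mult split: prod.splits)
  also have "\<dots> = (\<Sum>\<^sub>\<infinity>x\<in>UNIV. cnj (a x) * b x)"
    by (rule infsum_reindex_bij_witness[of _ uminus uminus]) auto
  finally show ?thesis .
qed

lemma mult_monomial:
  "mult \<theta> (monomial p q) (monomial r s) = (\<lambda>x. phase \<theta> (- (q * r)) * monomial (p + r) (q + s) x)"
proof
  fix x :: "int \<times> int"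
  obtain m n where x: "x = (m, n)" by (cases x)
  have "mult \<theta> (monomial p q) (monomial r s) x =
      (\<Sum>\<^sub>\<infinity>y\<in>{(p, q)}. phase \<theta> (- (snd y * (m - fst y))) * monomial p q y * monomial r s (m - fst y, n - snd y))"
    unfolding mult_def x prod.case by (rule infsum_cong_neutral) (auto simp: monomial_def split: if_splits)
  then show "mult \<theta> (monomial p q) (monomial r s) x = phase \<theta> (- (q * r)) * monomial (p + r) (q + s) x"
    unfolding monomial_def x by auto
qed

lemma generators_relation:
  "mult \<theta> U_gen V_gen = (\<lambda>x. exp (2 * pi * \<i> * \<theta>) * mult \<theta> V_gen U_gen x)"
  by (rule ext) (simp add: mult_monomial phase_def cis_conv_exp exp_minus algebra_simps)

lemma norm_vector_scalar_mult: "norm (c *s v) = cmod c * norm (v :: complex ^ 2)"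
  by (simp add: norm_vec_def L2_set_def norm_mult power_mult_distrib sum_distrib_left[symmetric]
      real_sqrt_mult)

lemma summable_on_weight:
  "(\<lambda>(p :: int, q :: int). 1 / ((1 + real_of_int \<bar>p\<bar>)\<^sup>2 * (1 + real_of_int \<bar>q\<bar>)\<^sup>2)) summable_on UNIV"
proof -
  define w :: "int \<Rightarrow> real" where "w p = 1 / (1 + real_of_int \<bar>p\<bar>)\<^sup>2" for p
  have "summable (\<lambda>n. inverse (real (Suc n) ^ 2))"
    using inverse_power_summable[where 'a = real, of 2] by (subst summable_Suc_iff) simp
  then have "summable (\<lambda>n. norm (w (int n)))"
    by (simp add: w_def inverse_eq_divide)
  then have nat: "(\<lambda>n. w (int n)) summable_on UNIV"
    by (rule norm_summable_imp_summable_on)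
  then have "w summable_on range int"
    by (subst summable_on_reindex) (auto simp: o_def)
  moreover have "w summable_on (\<lambda>n. - int n) ` {0<..}"
    by (subst summable_on_reindex)
      (auto simp: o_def inj_on_def w_def intro: summable_on_subset_banach nat[unfolded w_def, simplified])
  ultimately have "w summable_on (range int \<union> (\<lambda>n. - int n) ` {0<..})"
    by (rule summable_on_Un_disjoint) auto
  also have "range int \<union> (\<lambda>n. - int n) ` {0<..} = UNIV"
  proof -
    have "x \<in> range int \<union> (\<lambda>n. - int n) ` {0<..}" for x
      by (cases x rule: int_cases2) (cases "x = 0"; force)+
    then show ?thesis by blast
  qed
  finally have w: "w summable_on UNIV" .
  have w0: "w x \<ge> 0" for x by (simp add: w_def)
  have "(\<lambda>(p, q). w p * w q) summable_on (UNIV \<times> UNIV)"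
  proof (rule summable_on_SigmaI[where g = "\<lambda>p. w p * infsum w UNIV"])
    show "((\<lambda>y. case (x, y) of (p, q) \<Rightarrow> w p * w q) has_sum w x * infsum w UNIV) UNIV" for x
      using has_sum_cmult_right[OF has_sum_infsum[OF w], of "w x"] by simp
    show "(\<lambda>p. w p * infsum w UNIV) summable_on UNIV"
      using summable_on_cmult_left[OF w] .
  qed (auto simp: w0)
  then show ?thesis by (simp add: w_def case_prod_unfold)
qed

lemma smooth_summable:
  assumes "a \<in> smooth"
  shows "(\<lambda>(p, q). (1 + \<bar>real_of_int p\<bar> + \<bar>real_of_int q\<bar>) * cmod (a (p, q))) summable_on UNIV"
proof -
  obtain C where C: "\<And>m n. (1 + \<bar>real_of_int m\<bar> + \<bar>real_of_int n\<bar>) ^ 5 * cmod (a (m, n)) \<le> C"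
    using assms unfolding smooth_def by blast
  have le: "(1 + \<bar>real_of_int p\<bar> + \<bar>real_of_int q\<bar>) * cmod (a (p, q)) \<le>
      C * (1 / ((1 + real_of_int \<bar>p\<bar>)\<^sup>2 * (1 + real_of_int \<bar>q\<bar>)\<^sup>2))" for p q
  proof -
    define s where "s = 1 + \<bar>real_of_int p\<bar> + \<bar>real_of_int q\<bar>"
    have "(1 + real_of_int \<bar>p\<bar>)\<^sup>2 * (1 + real_of_int \<bar>q\<bar>)\<^sup>2 \<le> s\<^sup>2 * s\<^sup>2"
      unfolding s_def by (intro mult_mono power_mono) auto
    then have "(s * cmod (a (p, q))) * ((1 + real_of_int \<bar>p\<bar>)\<^sup>2 * (1 + real_of_int \<bar>q\<bar>)\<^sup>2)
        \<le> (s * cmod (a (p, q))) * (s\<^sup>2 * s\<^sup>2)"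
      by (intro mult_left_mono) (auto simp: s_def)
    also have "\<dots> = s ^ 5 * cmod (a (p, q))"
      by (simp add: power2_eq_square numeral_eq_Suc)
    also have "\<dots> \<le> C" using C unfolding s_def .
    finally have "s * cmod (a (p, q)) \<le> C / ((1 + real_of_int \<bar>p\<bar>)\<^sup>2 * (1 + real_of_int \<bar>q\<bar>)\<^sup>2)"
      by (subst pos_le_divide_eq) (auto intro!: mult_pos_pos zero_less_power)
    then show ?thesis unfolding s_def by simp
  qed
  have "(\<lambda>x. C * (case x of (p, q) \<Rightarrow> 1 / ((1 + real_of_int \<bar>p\<bar>)\<^sup>2 * (1 + real_of_int \<bar>q\<bar>)\<^sup>2))) summable_on UNIV"
    by (rule summable_on_cmult_right[OF summable_on_weight])
  then show ?thesis
    by (rule summable_on_comparison_test) (use le in auto)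
qed

lemma hilb_bounded:
  assumes "\<psi> \<in> hilb"
  obtains K where "K \<ge> 0" "\<And>x. norm (\<psi> x) \<le> K"
proof
  show "hnorm \<psi> \<ge> 0" by (simp add: hnorm_def infsum_nonneg)
  fix x
  have "(\<Sum>y\<in>{x}. (norm (\<psi> y))\<^sup>2) \<le> (\<Sum>\<^sub>\<infinity>y\<in>UNIV. (norm (\<psi> y))\<^sup>2)"
    using assms unfolding hilb_def by (intro finite_sum_le_infsum) auto
  then show "norm (\<psi> x) \<le> hnorm \<psi>"
    unfolding hnorm_def by (intro real_le_rsqrt) simp
qed

lemma lact_summable:
  assumes "a \<in> smooth" "\<psi> \<in> hilb"
    and c: "\<And>p q. cmod (c (p, q)) \<le> K * (1 + \<bar>real_of_int p\<bar> + \<bar>real_of_int q\<bar>) * cmod (a (p, q))"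
  shows "(\<lambda>(p, q). (phase \<theta> (- (q * (m - p))) * c (p, q)) *s \<psi> (m - p, n - q)) summable_on UNIV"
proof -
  obtain L where L: "L \<ge> 0" "\<And>x. norm (\<psi> x) \<le> L" using hilb_bounded[OF assms(2)] by blast
  have "(\<lambda>x. (K * L) * (case x of (p, q) \<Rightarrow> (1 + \<bar>real_of_int p\<bar> + \<bar>real_of_int q\<bar>) * cmod (a (p, q)))) summable_on UNIV"
    by (rule summable_on_cmult_right[OF smooth_summable[OF assms(1)]])
  then have "(\<lambda>x. norm (case x of (p, q) \<Rightarrow> (phase \<theta> (- (q * (m - p))) * c (p, q)) *s \<psi> (m - p, n - q))) summable_on UNIV"
  proof (rule Infinite_Sum.abs_summable_on_comparison_test')
    fix x :: "int \<times> int"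
    obtain p q where x: "x = (p, q)" by (cases x)
    have "cmod (c (p, q)) * norm (\<psi> (m - p, n - q))
        \<le> (K * (1 + \<bar>real_of_int p\<bar> + \<bar>real_of_int q\<bar>) * cmod (a (p, q))) * L"
      using order_trans[OF norm_ge_zero c] by (intro mult_mono c L) auto
    then show "norm (case x of (p, q) \<Rightarrow> (phase \<theta> (- (q * (m - p))) * c (p, q)) *s \<psi> (m - p, n - q))
        \<le> (K * L) * (case x of (p, q) \<Rightarrow> (1 + \<bar>real_of_int p\<bar> + \<bar>real_of_int q\<bar>) * cmod (a (p, q)))"
      by (simp add: x norm_vector_scalar_mult norm_mult phase_def mult_ac)
  qed
  then show ?thesis by (rule abs_summable_summable)
qed

lemma bounded_linear_vector_scalar_mult: "bounded_linear (\<lambda>v :: complex ^ 2. c *s v)"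
  by (rule bounded_linear_intro[where K = "cmod c"])
    (auto simp: vec_eq_iff norm_vector_scalar_mult algebra_simps)

lemma bounded_linear_matrix_vector: "bounded_linear (\<lambda>v :: complex ^ 2. (M :: complex ^ 2 ^ 2) *v v)"
  by (rule matrix_vector_mul_bounded_linear)

lemma comm_dirac_lact:
  assumes "a \<in> smooth" "\<psi> \<in> hilb"
  shows "comm dirac (lact \<theta> a) \<psi> = \<sigma>1 (lact \<theta> (der1 a) \<psi>) + \<sigma>2 (lact \<theta> (der2 a) \<psi>)"
proof
  fix x :: "int \<times> int"
  obtain m n where x: "x = (m, n)" by (cases x)
  define f where "f c = (\<lambda>(p, q). (phase \<theta> (- (q * (m - p))) * c (p, q)) *s \<psi> (m - p, n - q))"
    for c :: coeffs
  define g where "g c = infsum (f c) UNIV" for c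
  have "f a summable_on UNIV"
    unfolding f_def by (rule lact_summable[OF assms, of _ 1]) (simp add: mult_le_cancel_right1)
  then have 0: "(f a has_sum g a) UNIV" by (simp add: g_def)
  have "f (der1 a) summable_on UNIV"
    unfolding f_def
    by (rule lact_summable[OF assms, of _ 1]) (auto simp: der1_def norm_mult intro!: mult_right_mono)
  then have 1: "(f (der1 a) has_sum g (der1 a)) UNIV" by (simp add: g_def)
  have "f (der2 a) summable_on UNIV"
    unfolding f_def
    by (rule lact_summable[OF assms, of _ 1]) (auto simp: der2_def norm_mult intro!: mult_right_mono)
  then have 2: "(f (der2 a) has_sum g (der2 a)) UNIV" by (simp add: g_def)
  have diff: "((\<lambda>x. u x - v x) has_sum (c - d)) UNIV" if "(u has_sum c) UNIV" "(v has_sum d) UNIV"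
    for u v :: "int \<times> int \<Rightarrow> complex ^ 2" and c d
    using has_sum_add[OF that(1), of "\<lambda>x. - v x" "- d"] that(2) by (simp add: has_sum_uminus)
  note bl = has_sum_bounded_linear[OF bounded_linear_matrix_vector]
    has_sum_bounded_linear[OF bounded_linear_vector_scalar_mult]
  have "((\<lambda>x. (pauli1 *v (of_int m *s f a x) - pauli1 *v f (der1 a) x)
        + (pauli2 *v (of_int n *s f a x) - pauli2 *v f (der2 a) x)) has_sum
      ((pauli1 *v (of_int m *s g a) - pauli1 *v g (der1 a))
        + (pauli2 *v (of_int n *s g a) - pauli2 *v g (der2 a)))) UNIV"
    by (intro has_sum_add diff bl 0 1 2)
  then have "lact \<theta> a (dirac \<psi>) x = (pauli1 *v (of_int m *s g a) - pauli1 *v g (der1 a))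
        + (pauli2 *v (of_int n *s g a) - pauli2 *v g (der2 a))"
    unfolding lact_def dirac_def spin_def \<delta>1_def \<delta>2_def x prod.case
    by (intro infsumI, elim has_sum_cong[THEN iffD1, rotated])
      (auto simp: f_def der1_def der2_def vec_eq_iff algebra_simps matrix_vector_mult_def
        sum_2 split: prod.splits)
  moreover have "lact \<theta> c \<psi> x = g c" for c
    by (simp add: lact_def f_def g_def x)
  moreover have "dirac \<phi> x = pauli1 *v (of_int m *s \<phi> x) + pauli2 *v (of_int n *s \<phi> x)" for \<phi>
    by (simp add: dirac_def spin_def \<delta>1_def \<delta>2_def x)
  ultimately show "comm dirac (lact \<theta> a) \<psi> x = (\<sigma>1 (lact \<theta> (der1 a) \<psi>) + \<sigma>2 (lact \<theta> (der2 a) \<psi>)) x"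
    by (simp add: comm_def spin_def)
qed

lemma J_J: "J \<theta> (J \<theta> \<psi>) = - \<psi>"
proof
  fix x :: "int \<times> int"
  obtain m n where x: "x = (m, n)" by (cases x)
  have "phase \<theta> (- (m * n)) * cnj (phase \<theta> (- (m * n))) = 1"
    by (simp add: phase_def cis_cnj cis_mult)
  then show "J \<theta> (J \<theta> \<psi>) x = (- \<psi>) x"
    by (simp add: J_def x vec_eq_iff forall_2 matrix_vector_mult_def sum_2 pauli2_def mult_ac)
qed

lemma bij_J: "bij (J \<theta>)"
  by (rule o_bij[of "J \<theta> \<circ> J \<theta> \<circ> J \<theta>"]) (simp_all add: fun_eq_iff J_J)

lemma bij_j0: "bij (j0 \<theta>)"
proof -
  have "\<gamma> (\<gamma> \<psi>) = \<psi>" for \<psi>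
    by (simp add: spin_def pauli3_def fun_eq_iff vec_eq_iff forall_2 matrix_vector_mult_def sum_2)
  then have "bij \<gamma>" by (intro o_bij[of \<gamma>]) (auto simp: fun_eq_iff)
  then show ?thesis unfolding j0_def using bij_J by (rule bij_comp[rotated])
qed

end

theory Submission
  imports Defs
begin

text \<open>
  On Fourier coefficients the Hilbert space is \<open>\<ell>\<^sup>2(\<int> \<times> \<int>; \<complex>\<^sup>2)\<close>, and conjugation by \<open>J\<close> turns the
  left multiplication by \<open>a\<^sup>*\<close> into the right multiplication \<open>rmul \<theta> a\<close>. For \<open>w = \<omega>1\<close>
  selfadjoint, the operator \<open>j0 w j0\<^sup>-\<^sup>1\<close> is therefore the right multiplication by \<open>w\<close> (lemma
  \<open>j0_lact\<close>), and the operator of the theorem is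
  \<open>D' = \<sigma>1 (\<delta>1 - w \<delta>2) + \<sigma>2 \<delta>2\<close> with \<open>w\<close> acting from the right. Its horizontal part is
  \<open>\<sigma>1 A\<close> for \<open>A = \<delta>1 - w \<delta>2\<close>.

  \<^bold>\<open>Analysis.\<close> The element \<open>w\<close> has weight zero, so right multiplication by it commutes with
  \<open>\<delta>2\<close>, and \<open>A\<close> and \<open>\<delta>2\<close> are commuting symmetric operators. Since \<open>\<sigma>1\<close> and \<open>\<sigma>2\<close> anticommute, this
  gives \<open>\<parallel>D' \<psi>\<parallel>\<^sup>2 = \<parallel>A \<psi>\<parallel>\<^sup>2 + \<parallel>\<delta>2 \<psi>\<parallel>\<^sup>2\<close> (lemma \<open>twist_norm\<close>). The
  perturbation \<open>w \<delta>2\<close> can be large relative to \<open>D\<close>, but the norm identity shows that the graph norms of \<open>D'\<close> and \<open>D\<close> are equivalent.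
  Selfadjointness on the domain of \<open>D\<close> follows by cutting a vector in the domain of the adjoint off to
  \<open>|n| \<le> N\<close>, where \<open>\<delta>2\<close> is bounded, and applying the identity to the cut-off vectors uniformly in \<open>N\<close>
  (lemma \<open>twist_adjoint_domain\<close>). Compactness of the resolvent follows from the compact
  embedding of the domain of \<open>D\<close> (lemma \<open>rellich\<close>). Commutators with the algebra are bounded
  because left and right multiplications commute.

  \<^bold>\<open>Compatibility.\<close> In \<open>\<nabla>\<^sub>\<omega> a = [D, a] - \<delta>2(a) \<omega>\<close> the terms with \<open>\<sigma>2\<close> cancel, so that \<open>\<nabla>\<^sub>\<omega> a\<close> is
  \<open>\<sigma>1 (\<delta>1(a) - \<delta>2(a) w)\<close>. A presentation \<open>\<Sum> b' [D, b] a'\<close> of it has the form \<open>\<sigma>1 \<Sum> b' \<delta>1(b) a'\<close>, and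
  faithfulness of the left action identifies the two coefficients. The right action of the form is
  given by the same coefficient, and the Leibniz rule yields \<open>D\<^sub>\<omega> (h a) = \<sigma>1 A (h a)\<close>
  for every presentation (lemma \<open>twisted_dirac_covariant\<close>). Conversely every finitely supported
  vector is a sum of vectors \<open>h V\<^sup>n\<close> with \<open>h\<close> of weight zero, so that \<open>D\<^sub>\<omega>\<close> and the horizontal part of
  \<open>D'\<close> agree on a dense subspace.
\<close>

section \<open>Square summable spinors\<close>

text \<open>Membership in \<open>hilb\<close> and bounds on \<open>hnorm\<close> are reduced to bounds on the finite \<open>L2_set\<close>
  norms. These satisfy Minkowski's inequality and are continuous in the vector, so estimates pass
  to coordinatewise limits.\<close>

lemma L2_set_le_hnorm:
  assumes "\<psi> \<in> hilb"
  shows "L2_set (\<lambda>x. norm (\<psi> x)) F \<le> hnorm \<psi>"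
proof (cases "finite F")
  case True
  then have "(\<Sum>x\<in>F. (norm (\<psi> x))\<^sup>2) \<le> (\<Sum>\<^sub>\<infinity>x\<in>UNIV. (norm (\<psi> x))\<^sup>2)"
    using assms unfolding hilb_def by (intro finite_sum_le_infsum) auto
  then show ?thesis by (simp add: L2_set_def hnorm_def)
qed (simp add: hnorm_def infsum_nonneg)

lemma hilb_hnorm_leI:
  assumes "K \<ge> 0" "\<And>F. finite F \<Longrightarrow> L2_set (\<lambda>x. norm (\<psi> x)) F \<le> K"
  shows "\<psi> \<in> hilb" "hnorm \<psi> \<le> K"
proof -
  have le: "(\<Sum>x\<in>F. (norm (\<psi> x))\<^sup>2) \<le> K\<^sup>2" if "finite F" for F
    using assms(2)[OF that] unfolding L2_set_def by (rule sqrt_le_D)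
  have s: "(\<lambda>x. (norm (\<psi> x))\<^sup>2) summable_on UNIV"
    by (rule nonneg_bdd_above_summable_on) (auto intro!: bdd_aboveI[of _ "K\<^sup>2"] le)
  then show "\<psi> \<in> hilb" by (simp add: hilb_def)
  have "(\<Sum>\<^sub>\<infinity>x\<in>UNIV. (norm (\<psi> x))\<^sup>2) \<le> K\<^sup>2"
    by (rule infsum_le_finite_sums[OF s]) (auto intro: le)
  then show "hnorm \<psi> \<le> K"
    unfolding hnorm_def using assms(1) real_le_lsqrt by (simp add: real_le_lsqrt infsum_nonneg)
qed

lemma hnorm_nonneg [simp]: "hnorm \<psi> \<ge> 0"
  by (simp add: hnorm_def infsum_nonneg)

lemma hnorm_sq: "(hnorm \<psi>)\<^sup>2 = (\<Sum>\<^sub>\<infinity>x\<in>UNIV. (norm (\<psi> x))\<^sup>2)"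
  by (simp add: hnorm_def infsum_nonneg)

lemma norm_le_hnorm: "\<psi> \<in> hilb \<Longrightarrow> norm (\<psi> x) \<le> hnorm \<psi>"
  using L2_set_le_hnorm[of \<psi> "{x}"] by (simp add: L2_set_def)

lemma hilb_dominated:
  assumes "\<psi> \<in> hilb" "\<And>x. norm (\<phi> x) \<le> K * norm (\<psi> x)" "K \<ge> 0"
  shows "\<phi> \<in> hilb" "hnorm \<phi> \<le> K * hnorm \<psi>"
proof -
  have "L2_set (\<lambda>x. norm (\<phi> x)) F \<le> K * hnorm \<psi>" for F
  proof -
    have "L2_set (\<lambda>x. norm (\<phi> x)) F \<le> L2_set (\<lambda>x. K * norm (\<psi> x)) F"
      by (rule L2_set_mono) (auto intro: assms)
    also have "\<dots> \<le> K * hnorm \<psi>"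
      by (simp add: L2_set_right_distrib[symmetric] assms mult_left_mono L2_set_le_hnorm)
    finally show ?thesis .
  qed
  then show "\<phi> \<in> hilb" "hnorm \<phi> \<le> K * hnorm \<psi>"
    using hilb_hnorm_leI[of "K * hnorm \<psi>" \<phi>] assms(3) by auto
qed

lemma hilb_add:
  assumes "\<phi> \<in> hilb" "\<psi> \<in> hilb"
  shows "\<phi> + \<psi> \<in> hilb" "hnorm (\<phi> + \<psi>) \<le> hnorm \<phi> + hnorm \<psi>"
proof -
  have "L2_set (\<lambda>x. norm ((\<phi> + \<psi>) x)) F \<le> hnorm \<phi> + hnorm \<psi>" for F
  proof -
    have "L2_set (\<lambda>x. norm ((\<phi> + \<psi>) x)) F \<le> L2_set (\<lambda>x. norm (\<phi> x) + norm (\<psi> x)) F"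
      by (rule L2_set_mono) (auto intro: norm_triangle_ineq)
    also have "\<dots> \<le> hnorm \<phi> + hnorm \<psi>"
      by (rule order_trans[OF L2_set_triangle_ineq add_mono[OF L2_set_le_hnorm[OF assms(1)] L2_set_le_hnorm[OF assms(2)]]])
    finally show ?thesis .
  qed
  then show "\<phi> + \<psi> \<in> hilb" "hnorm (\<phi> + \<psi>) \<le> hnorm \<phi> + hnorm \<psi>"
    using hilb_hnorm_leI[of "hnorm \<phi> + hnorm \<psi>" "\<phi> + \<psi>"] by auto
qed

lemma hilb_scale [simp]: "\<psi> \<in> hilb \<Longrightarrow> scale c \<psi> \<in> hilb"
  and hnorm_scale_le: "\<psi> \<in> hilb \<Longrightarrow> hnorm (scale c \<psi>) \<le> cmod c * hnorm \<psi>"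
  using hilb_dominated[of \<psi> "scale c \<psi>" "cmod c"] by (auto simp: scale_def norm_vector_scalar_mult)

lemma hilb_uminus: "\<psi> \<in> hilb \<Longrightarrow> - \<psi> \<in> hilb"
  and hnorm_uminus: "hnorm (- \<psi>) = hnorm \<psi>"
  by (simp_all add: hilb_def hnorm_def)

lemma hilb_diff:
  assumes "\<phi> \<in> hilb" "\<psi> \<in> hilb"
  shows "\<phi> - \<psi> \<in> hilb" "hnorm (\<phi> - \<psi>) \<le> hnorm \<phi> + hnorm \<psi>"
  using hilb_add[OF assms(1) hilb_uminus[OF assms(2)]] by (simp_all add: hnorm_uminus)

lemma hilb_zero [simp]: "0 \<in> hilb"
  by (simp add: hilb_def)

lemma norm_complex2: "norm (v :: complex ^ 2) = sqrt ((cmod (v $ 1))\<^sup>2 + (cmod (v $ 2))\<^sup>2)"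
  by (simp add: norm_vec_def L2_set_def sum_2)

lemmas pauli_defs = pauli1_def pauli2_def pauli3_def

lemma norm_pauli [simp]:
  "norm (pauli1 *v v) = norm v" "norm (pauli2 *v v) = norm v" "norm (pauli3 *v v) = norm v"
  by (simp_all add: norm_complex2 pauli_defs matrix_vector_mult_def sum_2 norm_mult)

lemma hilb_pauli [simp]:
  "\<psi> \<in> hilb \<Longrightarrow> \<sigma>1 \<psi> \<in> hilb" "\<psi> \<in> hilb \<Longrightarrow> \<sigma>2 \<psi> \<in> hilb" "\<psi> \<in> hilb \<Longrightarrow> \<gamma> \<psi> \<in> hilb"
  by (simp_all add: hilb_def spin_def)

lemma hnorm_pauli [simp]:
  "hnorm (\<sigma>1 \<psi>) = hnorm \<psi>" "hnorm (\<sigma>2 \<psi>) = hnorm \<psi>" "hnorm (\<gamma> \<psi>) = hnorm \<psi>"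
  by (simp_all add: hnorm_def spin_def)

lemma spin_linear:
  "spin M (\<phi> + \<psi>) = spin M \<phi> + spin M \<psi>" "spin M (\<phi> - \<psi>) = spin M \<phi> - spin M \<psi>"
  "spin M (- \<psi>) = - spin M \<psi>" "spin M 0 = 0" "spin M (scale c \<psi>) = scale c (spin M \<psi>)"
  by (simp_all add: spin_def scale_def fun_eq_iff vec_eq_iff matrix_vector_mult_def algebra_simps
      sum.distrib sum_subtractf sum_distrib_left sum_negf)

lemma pauli_products:
  "\<sigma>1 (\<sigma>1 \<psi>) = \<psi>" "\<sigma>2 (\<sigma>2 \<psi>) = \<psi>" "\<gamma> (\<gamma> \<psi>) = \<psi>"
  "\<sigma>2 (\<sigma>1 \<psi>) = - \<sigma>1 (\<sigma>2 \<psi>)" "\<sigma>1 (\<sigma>2 \<psi>) = scale \<i> (\<gamma> \<psi>)"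
  by (simp_all add: spin_def scale_def fun_eq_iff vec_eq_iff forall_2 matrix_vector_mult_def sum_2 pauli_defs)

lemma scale_linear:
  "scale c (\<phi> + \<psi>) = scale c \<phi> + scale c \<psi>" "scale c (\<phi> - \<psi>) = scale c \<phi> - scale c \<psi>"
  "scale (c + d) \<psi> = scale c \<psi> + scale d \<psi>" "scale c (scale d \<psi>) = scale (c * d) \<psi>"
  "scale 0 \<psi> = 0" "scale 1 \<psi> = \<psi>" "scale c 0 = 0" "scale c (- \<psi>) = - scale c \<psi>"
  by (simp_all add: scale_def fun_eq_iff vec_eq_iff algebra_simps)

lemma delta_linear:
  "\<delta>1 (\<phi> + \<psi>) = \<delta>1 \<phi> + \<delta>1 \<psi>" "\<delta>1 (\<phi> - \<psi>) = \<delta>1 \<phi> - \<delta>1 \<psi>" "\<delta>1 0 = 0"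
  "\<delta>2 (\<phi> + \<psi>) = \<delta>2 \<phi> + \<delta>2 \<psi>" "\<delta>2 (\<phi> - \<psi>) = \<delta>2 \<phi> - \<delta>2 \<psi>" "\<delta>2 0 = 0"
  "\<delta>1 (spin M \<psi>) = spin M (\<delta>1 \<psi>)" "\<delta>2 (spin M \<psi>) = spin M (\<delta>2 \<psi>)"
  by (auto simp add: \<delta>1_def \<delta>2_def spin_def fun_eq_iff vec_eq_iff matrix_vector_mult_def algebra_simps
      sum.distrib sum_subtractf sum_distrib_left sum_negf split: prod.splits)

definition cdot :: "complex ^ 2 \<Rightarrow> complex ^ 2 \<Rightarrow> complex" where
  "cdot u v = (\<Sum>i\<in>UNIV. cnj (u $ i) * v $ i)"

lemma norm_cdot: "cmod (cdot u v) \<le> norm u * norm v"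
proof -
  have "cmod (cdot u v) \<le> (\<Sum>i\<in>UNIV. \<bar>norm (u $ i)\<bar> * \<bar>norm (v $ i)\<bar>)"
    unfolding cdot_def by (rule order_trans[OF norm_sum]) (simp add: norm_mult)
  also have "\<dots> \<le> norm u * norm v"
    unfolding norm_vec_def by (rule L2_set_mult_ineq)
  finally show ?thesis .
qed

lemma cdot_self: "cdot u u = of_real ((norm u)\<^sup>2)"
  by (simp add: cdot_def sum_2 norm_complex2 complex_norm_square[symmetric] mult.commute)

lemma cdot_cnj: "cnj (cdot u v) = cdot v u"
  by (simp add: cdot_def mult.commute)

lemma cdot_linear:
  "cdot (u + v) w = cdot u w + cdot v w" "cdot w (u + v) = cdot w u + cdot w v"
  "cdot (u - v) w = cdot u w - cdot v w" "cdot w (u - v) = cdot w u - cdot w v"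
  "cdot (c *s u) w = cnj c * cdot u w" "cdot u (c *s w) = c * cdot u w"
  by (simp_all add: cdot_def sum_2 algebra_simps)

lemma cdot_pauli:
  "cdot u (pauli1 *v v) = cdot (pauli1 *v u) v" "cdot u (pauli2 *v v) = cdot (pauli2 *v u) v"
  "cdot u (pauli3 *v v) = cdot (pauli3 *v u) v"
  by (simp_all add: cdot_def pauli_defs matrix_vector_mult_def sum_2)

lemma hinner_cdot: "hinner \<phi> \<psi> = (\<Sum>\<^sub>\<infinity>x\<in>UNIV. cdot (\<phi> x) (\<psi> x))"
  by (simp add: hinner_def cdot_def)

lemma summable_norm_mult:
  assumes "\<phi> \<in> hilb" "\<psi> \<in> hilb"
  shows "(\<lambda>x. norm (\<phi> x) * norm (\<psi> x)) summable_on UNIV"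
    "(\<Sum>\<^sub>\<infinity>x. norm (\<phi> x) * norm (\<psi> x)) \<le> hnorm \<phi> * hnorm \<psi>"
proof -
  have le: "(\<Sum>x\<in>F. norm (\<phi> x) * norm (\<psi> x)) \<le> hnorm \<phi> * hnorm \<psi>" for F
  proof -
    have "(\<Sum>x\<in>F. norm (\<phi> x) * norm (\<psi> x)) \<le> L2_set (\<lambda>x. norm (\<phi> x)) F * L2_set (\<lambda>x. norm (\<psi> x)) F"
      using L2_set_mult_ineq[of "\<lambda>x. norm (\<phi> x)" "\<lambda>x. norm (\<psi> x)" F] by simp
    also have "\<dots> \<le> hnorm \<phi> * hnorm \<psi>"
      by (intro mult_mono L2_set_le_hnorm assms) auto
    finally show ?thesis .
  qed
  show s: "(\<lambda>x. norm (\<phi> x) * norm (\<psi> x)) summable_on UNIV"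
    by (rule nonneg_bdd_above_summable_on) (auto intro!: bdd_aboveI[of _ "hnorm \<phi> * hnorm \<psi>"] le)
  show "(\<Sum>\<^sub>\<infinity>x. norm (\<phi> x) * norm (\<psi> x)) \<le> hnorm \<phi> * hnorm \<psi>"
    by (rule infsum_le_finite_sums[OF s]) (auto intro: le)
qed

lemma hinner_summable:
  assumes "\<phi> \<in> hilb" "\<psi> \<in> hilb"
  shows "(\<lambda>x. cdot (\<phi> x) (\<psi> x)) summable_on UNIV"
proof -
  have "(\<lambda>x. norm (cdot (\<phi> x) (\<psi> x))) summable_on UNIV"
    by (rule Infinite_Sum.abs_summable_on_comparison_test'[OF summable_norm_mult(1)[OF assms]])
      (rule norm_cdot)
  then show ?thesis by (rule abs_summable_summable)
qed

lemma hinner_linear: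
  assumes "\<phi> \<in> hilb" "\<psi> \<in> hilb" "\<zeta> \<in> hilb"
  shows "hinner (\<phi> + \<psi>) \<zeta> = hinner \<phi> \<zeta> + hinner \<psi> \<zeta>" "hinner \<zeta> (\<phi> + \<psi>) = hinner \<zeta> \<phi> + hinner \<zeta> \<psi>"
    "hinner (\<phi> - \<psi>) \<zeta> = hinner \<phi> \<zeta> - hinner \<psi> \<zeta>" "hinner \<zeta> (\<phi> - \<psi>) = hinner \<zeta> \<phi> - hinner \<zeta> \<psi>"
proof -
  note s = hinner_summable[OF assms(1,3)] hinner_summable[OF assms(2,3)]
    hinner_summable[OF assms(3,1)] hinner_summable[OF assms(3,2)]
  show "hinner (\<phi> + \<psi>) \<zeta> = hinner \<phi> \<zeta> + hinner \<psi> \<zeta>" "hinner \<zeta> (\<phi> + \<psi>) = hinner \<zeta> \<phi> + hinner \<zeta> \<psi>"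
    by (simp_all add: hinner_cdot cdot_linear infsum_add s)
  show "hinner (\<phi> - \<psi>) \<zeta> = hinner \<phi> \<zeta> - hinner \<psi> \<zeta>" "hinner \<zeta> (\<phi> - \<psi>) = hinner \<zeta> \<phi> - hinner \<zeta> \<psi>"
    using infsum_add[OF s(1) summable_on_uminus[THEN iffD2, OF s(2)]]
      infsum_add[OF s(3) summable_on_uminus[THEN iffD2, OF s(4)]]
    by (simp_all add: hinner_cdot cdot_linear infsum_uminus)
qed

lemma hinner_scale: "hinner \<phi> (scale c \<psi>) = c * hinner \<phi> \<psi>" "hinner (scale c \<phi>) \<psi> = cnj c * hinner \<phi> \<psi>"
  by (simp_all add: hinner_cdot scale_def cdot_linear infsum_cmult_right')

lemma hinner_cnj: "cnj (hinner \<phi> \<psi>) = hinner \<psi> \<phi>"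
  by (simp add: hinner_cdot cdot_cnj flip: infsum_cnj)

lemma hinner_pauli:
  "hinner \<phi> (\<sigma>1 \<psi>) = hinner (\<sigma>1 \<phi>) \<psi>" "hinner \<phi> (\<sigma>2 \<psi>) = hinner (\<sigma>2 \<phi>) \<psi>"
  "hinner \<phi> (\<gamma> \<psi>) = hinner (\<gamma> \<phi>) \<psi>"
  by (simp_all add: hinner_cdot spin_def cdot_pauli)

lemma hinner_delta: "hinner \<phi> (\<delta>1 \<psi>) = hinner (\<delta>1 \<phi>) \<psi>" "hinner \<phi> (\<delta>2 \<psi>) = hinner (\<delta>2 \<phi>) \<psi>"
  by (auto simp add: hinner_cdot \<delta>1_def \<delta>2_def cdot_linear case_prod_unfold)

lemma hinner_self:
  assumes "\<psi> \<in> hilb"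
  shows "hinner \<psi> \<psi> = of_real ((hnorm \<psi>)\<^sup>2)"
proof -
  have "hinner \<psi> \<psi> = (\<Sum>\<^sub>\<infinity>x. complex_of_real ((norm (\<psi> x))\<^sup>2))"
    by (simp add: hinner_cdot cdot_self)
  also have "\<dots> = of_real ((hnorm \<psi>)\<^sup>2)"
    using assms unfolding hnorm_sq hilb_def by (intro infsumI has_sum_of_real has_sum_infsum) simp
  finally show ?thesis .
qed

lemma hnorm_add_sq:
  assumes "\<phi> \<in> hilb" "\<psi> \<in> hilb"
  shows "(hnorm (\<phi> + \<psi>))\<^sup>2 = (hnorm \<phi>)\<^sup>2 + (hnorm \<psi>)\<^sup>2 + 2 * Re (hinner \<phi> \<psi>)"
proof -
  have "hinner (\<phi> + \<psi>) (\<phi> + \<psi>) = hinner \<phi> \<phi> + hinner \<psi> \<psi> + (hinner \<phi> \<psi> + cnj (hinner \<phi> \<psi>))"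
    by (simp add: hinner_linear hilb_add assms hinner_cnj)
  then have "of_real ((hnorm (\<phi> + \<psi>))\<^sup>2) = complex_of_real ((hnorm \<phi>)\<^sup>2 + (hnorm \<psi>)\<^sup>2 + 2 * Re (hinner \<phi> \<psi>))"
    unfolding complex_add_cnj by (simp add: hinner_self hilb_add assms)
  then show ?thesis by (simp only: of_real_eq_iff)
qed

definition unit_at :: "int \<times> int \<Rightarrow> complex ^ 2 \<Rightarrow> spinor" where
  "unit_at x v = (\<lambda>y. if y = x then v else 0)"

definition finite_support :: "spinor set" where
  "finite_support = {\<psi>. finite {x. \<psi> x \<noteq> 0}}"

lemma finite_support_hilb: "finite_support \<subseteq> hilb"
  unfolding finite_support_def hilb_def
  by (auto intro!: finite_nonzero_values_imp_summable_on)

lemma finite_support_unit [simp]: "unit_at x v \<in> finite_support"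
  by (simp add: finite_support_def unit_at_def)

lemma delta_unit:
  "\<delta>1 (unit_at (m, n) v) = scale (of_int m) (unit_at (m, n) v)"
  "\<delta>2 (unit_at (m, n) v) = scale (of_int n) (unit_at (m, n) v)"
  by (auto simp: unit_at_def \<delta>1_def \<delta>2_def scale_def fun_eq_iff)

lemma finite_support_dom_dirac: "finite_support \<subseteq> dom_dirac"
proof
  fix \<psi> assume \<psi>: "\<psi> \<in> finite_support"
  have "\<delta>1 \<psi> \<in> finite_support" "\<delta>2 \<psi> \<in> finite_support"
    using \<psi> by (auto simp: finite_support_def \<delta>1_def \<delta>2_def elim!: rev_finite_subset)
  then show "\<psi> \<in> dom_dirac"
    using \<psi> finite_support_hilb by (auto simp: dom_dirac_def)
qed

lemma hinner_unit: "hinner \<phi> (unit_at x v) = cdot (\<phi> x) v"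
proof -
  have "hinner \<phi> (unit_at x v) = (\<Sum>\<^sub>\<infinity>y\<in>{x}. cdot (\<phi> y) (unit_at x v y))"
    unfolding hinner_cdot by (rule infsum_cong_neutral) (auto simp: unit_at_def cdot_def)
  then show ?thesis by (simp add: unit_at_def)
qed

lemma cdot_eqI: 
  assumes "\<And>v. cdot u v = cdot w v"
  shows "u = w"
proof -
  have "cdot (u - w) (u - w) = 0" using assms by (simp add: cdot_linear)
  then show ?thesis by (simp add: cdot_self)
qed

text \<open>Finitely supported families lie in every domain that occurs below. They serve as test vectors and
  as the dense set on which the operators are compared.\<close>

lemma finite_support_dense: "dense_in_hilb finite_support"
  unfolding dense_in_hilb_def
proof (intro conjI ballI allI impI finite_support_hilb)
  fix \<psi> and \<epsilon> :: real assume \<psi>: "\<psi> \<in> hilb" and \<epsilon>: "\<epsilon> > 0"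
  define f where "f x = (norm (\<psi> x))\<^sup>2" for x
  have f: "f summable_on UNIV" using \<psi> by (simp add: hilb_def f_def[abs_def])
  obtain F where F: "finite F" "dist (sum f F) (infsum f UNIV) \<le> \<epsilon>\<^sup>2 / 2"
    using infsum_finite_approximation[OF f, of "\<epsilon>\<^sup>2 / 2"] \<epsilon> by auto
  define \<phi> where "\<phi> x = (if x \<in> F then \<psi> x else 0)" for x
  have "\<phi> \<in> finite_support"
    using F(1) by (auto simp: finite_support_def \<phi>_def elim!: rev_finite_subset)
  moreover have "infsum f UNIV = infsum f F + infsum f (- F)"
    using infsum_Un_disjoint[of f F "- F"] f F(1)
    by (auto intro: summable_on_subset_banach)
  then have "infsum f (- F) < \<epsilon>\<^sup>2"
    using F \<epsilon> by (auto simp: dist_real_def abs_le_iff intro: le_less_trans[of _ "\<epsilon>\<^sup>2/2"])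
  moreover have "(hnorm (\<psi> - \<phi>))\<^sup>2 = infsum f (- F)"
    unfolding hnorm_sq by (rule infsum_cong_neutral) (auto simp: \<phi>_def f_def)
  ultimately show "\<exists>\<phi>\<in>finite_support. hnorm (\<psi> - \<phi>) < \<epsilon>"
    using \<epsilon> by (metis power2_less_imp_less less_eq_real_def)
qed

section \<open>Twisted convolutions\<close>

text \<open>
  Left and right multiplication by a coefficient family are both of the form \<open>conv c\<close>, where the
  kernel \<open>c x y\<close> is the coefficient at \<open>y\<close> times a phase depending on \<open>x\<close>. All analytic facts
  about them only use that \<open>|c x y|\<close> is bounded by a summable function of \<open>y\<close>, which is what
  \<open>dominated\<close> records.
\<close>

definition conv :: "(int \<times> int \<Rightarrow> int \<times> int \<Rightarrow> complex) \<Rightarrow> oper" where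
  "conv c \<psi> = (\<lambda>x. \<Sum>\<^sub>\<infinity>y. c x y *s \<psi> (x - y))"

definition dominated :: "(int \<times> int \<Rightarrow> int \<times> int \<Rightarrow> complex) \<Rightarrow> (int \<times> int \<Rightarrow> real) \<Rightarrow> bool" where
  "dominated c \<alpha> \<longleftrightarrow> \<alpha> summable_on UNIV \<and> (\<forall>x y. cmod (c x y) \<le> \<alpha> y)"

lemma dominatedD:
  assumes "dominated c \<alpha>"
  shows "\<alpha> summable_on UNIV" "cmod (c x y) \<le> \<alpha> y" "0 \<le> \<alpha> y"
proof -
  show "\<alpha> summable_on UNIV" and le: "cmod (c x y) \<le> \<alpha> y"
    using assms by (simp_all only: dominated_def)
  show "0 \<le> \<alpha> y" using le norm_ge_zero order_trans by blast
qed

lemma conv_has_sum: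
  assumes c: "dominated c \<alpha>" and \<psi>: "\<psi> \<in> hilb"
  shows "((\<lambda>y. c x y *s \<psi> (x - y)) has_sum conv c \<psi> x) UNIV"
proof -
  have "(\<lambda>y. norm (c x y *s \<psi> (x - y))) summable_on UNIV"
  proof (rule Infinite_Sum.abs_summable_on_comparison_test')
    show "(\<lambda>y. \<alpha> y * hnorm \<psi>) summable_on UNIV"
      by (rule summable_on_cmult_left[OF dominatedD(1)[OF c]])
    show "norm (c x y *s \<psi> (x - y)) \<le> \<alpha> y * hnorm \<psi>" for y
      unfolding norm_vector_scalar_mult
      by (intro mult_mono dominatedD[OF c] norm_le_hnorm \<psi>) auto
  qed
  then have "(\<lambda>y. c x y *s \<psi> (x - y)) summable_on UNIV" by (rule abs_summable_summable)
  then show ?thesis unfolding conv_def by (rule has_sum_infsum)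
qed

lemma L2_set_sum_le:
  assumes "finite G"
  shows "L2_set (\<lambda>x. norm (\<Sum>y\<in>G. f x y)) F \<le> (\<Sum>y\<in>G. L2_set (\<lambda>x. norm (f x y)) F)"
  using assms
proof induction
  case (insert y G)
  have "L2_set (\<lambda>x. norm (\<Sum>y\<in>insert y G. f x y)) F
      \<le> L2_set (\<lambda>x. norm (f x y) + norm (\<Sum>y\<in>G. f x y)) F"
    using insert by (intro L2_set_mono) (auto intro: norm_triangle_ineq)
  also have "\<dots> \<le> L2_set (\<lambda>x. norm (f x y)) F + L2_set (\<lambda>x. norm (\<Sum>y\<in>G. f x y)) F"
    by (rule L2_set_triangle_ineq)
  finally show ?case using insert by simp
qed (simp add: L2_set_0')

text \<open>Young's inequality: \<open>conv c \<psi>\<close> is a limit of finite sums of translates of \<open>\<psi>\<close>, each of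
  norm at most \<open>\<alpha> y * hnorm \<psi>\<close>, so that Minkowski's inequality gives the bound.\<close>

lemma conv_hilb:
  assumes c: "dominated c \<alpha>" and \<psi>: "\<psi> \<in> hilb"
  shows "conv c \<psi> \<in> hilb" "hnorm (conv c \<psi>) \<le> infsum \<alpha> UNIV * hnorm \<psi>"
proof -
  note \<alpha> = dominatedD[OF c]
  have *: "L2_set (\<lambda>x. norm (conv c \<psi> x)) F \<le> infsum \<alpha> UNIV * hnorm \<psi>" if F: "finite F" for F
  proof (rule tendsto_upperbound)
    have "((\<lambda>G. \<Sum>y\<in>G. c x y *s \<psi> (x - y)) \<longlongrightarrow> conv c \<psi> x) (finite_subsets_at_top UNIV)" for x
      using conv_has_sum[OF assms] by (simp add: has_sum_def)
    then show "((\<lambda>G. L2_set (\<lambda>x. norm (\<Sum>y\<in>G. c x y *s \<psi> (x - y))) F)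
        \<longlongrightarrow> L2_set (\<lambda>x. norm (conv c \<psi> x)) F) (finite_subsets_at_top UNIV)"
      unfolding L2_set_def by (intro tendsto_intros)
    have "L2_set (\<lambda>x. norm (\<Sum>y\<in>G. c x y *s \<psi> (x - y))) F \<le> infsum \<alpha> UNIV * hnorm \<psi>"
      if G: "finite G" for G
    proof -
      have "L2_set (\<lambda>x. norm (c x y *s \<psi> (x - y))) F \<le> \<alpha> y * hnorm \<psi>" for y
      proof -
        have "L2_set (\<lambda>x. norm (c x y *s \<psi> (x - y))) F \<le> L2_set (\<lambda>x. \<alpha> y * norm (\<psi> (x - y))) F"
          by (rule L2_set_mono) (auto simp: norm_vector_scalar_mult intro!: mult_right_mono \<alpha>)
        also have "\<dots> = \<alpha> y * L2_set (\<lambda>x. norm (\<psi> x)) ((\<lambda>x. x - y) ` F)"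
          unfolding L2_set_right_distrib[OF \<alpha>(3), symmetric]
          by (subst L2_set_def, subst L2_set_def, subst sum.reindex) (auto simp: inj_on_def)
        also have "\<dots> \<le> \<alpha> y * hnorm \<psi>"
          by (intro mult_left_mono L2_set_le_hnorm \<psi> \<alpha>)
        finally show ?thesis .
      qed
      then have "L2_set (\<lambda>x. norm (\<Sum>y\<in>G. c x y *s \<psi> (x - y))) F \<le> (\<Sum>y\<in>G. \<alpha> y * hnorm \<psi>)"
        by (intro order_trans[OF L2_set_sum_le[OF G]] sum_mono)
      also have "\<dots> = (\<Sum>y\<in>G. \<alpha> y) * hnorm \<psi>" by (simp add: sum_distrib_right)
      also have "\<dots> \<le> infsum \<alpha> UNIV * hnorm \<psi>"
        by (intro mult_right_mono finite_sum_le_infsum \<alpha> G) auto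
      finally show ?thesis .
    qed
    then show "\<forall>\<^sub>F G in finite_subsets_at_top UNIV.
        L2_set (\<lambda>x. norm (\<Sum>y\<in>G. c x y *s \<psi> (x - y))) F \<le> infsum \<alpha> UNIV * hnorm \<psi>"
      by (intro eventually_finite_subsets_at_top_weakI) auto
  qed (rule finite_subsets_at_top_neq_bot)
  have "0 \<le> infsum \<alpha> UNIV * hnorm \<psi>" by (intro mult_nonneg_nonneg infsum_nonneg \<alpha>) auto
  from hilb_hnorm_leI[OF this, of "conv c \<psi>"] *
  show "conv c \<psi> \<in> hilb" "hnorm (conv c \<psi>) \<le> infsum \<alpha> UNIV * hnorm \<psi>" by simp_all
qed

lemma conv_spin:
  assumes "dominated c \<alpha>" "\<psi> \<in> hilb"
  shows "conv c (spin M \<psi>) = spin M (conv c \<psi>)"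
proof
  fix x
  have "((\<lambda>y. M *v (c x y *s \<psi> (x - y))) has_sum M *v conv c \<psi> x) UNIV"
    by (rule has_sum_bounded_linear[OF bounded_linear_matrix_vector conv_has_sum[OF assms]])
  then have "((\<lambda>y. c x y *s spin M \<psi> (x - y)) has_sum M *v conv c \<psi> x) UNIV"
    by (simp add: spin_def vector_scalar_commute)
  then show "conv c (spin M \<psi>) x = spin M (conv c \<psi>) x"
    unfolding conv_def spin_def by (rule infsumI)
qed

lemma conv_add:
  assumes "dominated c \<alpha>" "\<phi> \<in> hilb" "\<psi> \<in> hilb"
  shows "conv c (\<phi> + \<psi>) = conv c \<phi> + conv c \<psi>"
proof
  fix x
  have "((\<lambda>y. c x y *s (\<phi> + \<psi>) (x - y)) has_sum conv c \<phi> x + conv c \<psi> x) UNIV"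
    using has_sum_add[OF conv_has_sum[OF assms(1,2), where x = x] conv_has_sum[OF assms(1,3), where x = x]]
    by (simp only: plus_fun_apply vector_add_ldistrib)
  then show "conv c (\<phi> + \<psi>) x = (conv c \<phi> + conv c \<psi>) x"
    unfolding conv_def plus_fun_apply by (rule infsumI)
qed

lemma conv_scale:
  assumes "dominated c \<alpha>" "\<psi> \<in> hilb"
  shows "conv c (scale k \<psi>) = scale k (conv c \<psi>)"
proof
  fix x
  have "((\<lambda>y. k *s (c x y *s \<psi> (x - y))) has_sum k *s conv c \<psi> x) UNIV"
    by (rule has_sum_bounded_linear[OF bounded_linear_vector_scalar_mult conv_has_sum[OF assms]])
  then have "((\<lambda>y. c x y *s scale k \<psi> (x - y)) has_sum k *s conv c \<psi> x) UNIV"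
    by (simp add: scale_def mult.commute)
  then show "conv c (scale k \<psi>) x = scale k (conv c \<psi>) x"
    unfolding conv_def scale_def by (rule infsumI)
qed

lemma conv_zero [simp]: "conv c 0 = 0"
  unfolding conv_def by (rule ext) (simp only: zero_fun_apply vector_smult_rzero infsum_0_simp)

lemma conv_diff:
  assumes "dominated c \<alpha>" "\<phi> \<in> hilb" "\<psi> \<in> hilb"
  shows "conv c (\<phi> - \<psi>) = conv c \<phi> - conv c \<psi>"
proof -
  have "conv c ((\<phi> - \<psi>) + \<psi>) = conv c (\<phi> - \<psi>) + conv c \<psi>"
    by (rule conv_add[OF assms(1)]) (auto intro: hilb_diff assms)
  then show ?thesis by (simp add: algebra_simps)
qed

lemma conv_kernel_add:
  assumes "dominated c \<alpha>" "dominated d \<beta>" "\<psi> \<in> hilb"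
  shows "conv (\<lambda>x y. c x y + d x y) \<psi> = conv c \<psi> + conv d \<psi>"
proof
  fix x
  have "((\<lambda>y. (c x y + d x y) *s \<psi> (x - y)) has_sum conv c \<psi> x + conv d \<psi> x) UNIV"
    using has_sum_add[OF conv_has_sum[OF assms(1,3), where x = x] conv_has_sum[OF assms(2,3), where x = x]]
    by (simp only: vector_sadd_rdistrib)
  then show "conv (\<lambda>x y. c x y + d x y) \<psi> x = (conv c \<psi> + conv d \<psi>) x"
    unfolding conv_def plus_fun_apply by (rule infsumI)
qed

lemma conv_kernel_scale:
  assumes "dominated c \<alpha>" "\<psi> \<in> hilb"
  shows "conv (\<lambda>x y. k * c x y) \<psi> = scale k (conv c \<psi>)"
  unfolding conv_scale[OF assms, symmetric] by (simp add: conv_def scale_def mult_ac)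

text \<open>Since \<open>f (x - y) = f x - f y\<close>, multiplying by \<open>f\<close> before the convolution differs from doing so
  afterwards by the factor \<open>f y\<close>, which can be moved into the kernel. The family
  \<open>f \<psi>\<close> may fail to be square summable, so that the rule also covers formal computations with
  unbounded operators outside their domains.\<close>

lemma conv_Leibniz:
  assumes "dominated c \<alpha>" "dominated (\<lambda>x y. of_int (f y) * c x y) \<beta>" "\<psi> \<in> hilb"
    and f: "\<And>x y. f (x - y) = f x - f y"
  shows "conv c (\<lambda>x. of_int (f x) *s \<psi> x)
    = (\<lambda>x. of_int (f x) *s conv c \<psi> x) - conv (\<lambda>x y. of_int (f y) * c x y) \<psi>"
proof
  fix x
  have "((\<lambda>y. of_int (f x) *s (c x y *s \<psi> (x - y))) has_sum of_int (f x) *s conv c \<psi> x) UNIV"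
    by (rule has_sum_bounded_linear[OF bounded_linear_vector_scalar_mult conv_has_sum[OF assms(1,3)]])
  moreover have "((\<lambda>y. - ((of_int (f y) * c x y) *s \<psi> (x - y))) has_sum
      - conv (\<lambda>x y. of_int (f y) * c x y) \<psi> x) UNIV"
    unfolding has_sum_uminus using conv_has_sum[OF assms(2,3)] by simp
  ultimately have "((\<lambda>y. of_int (f x) *s (c x y *s \<psi> (x - y)) + - ((of_int (f y) * c x y) *s \<psi> (x - y))) has_sum
      of_int (f x) *s conv c \<psi> x + - conv (\<lambda>x y. of_int (f y) * c x y) \<psi> x) UNIV"
    by (rule has_sum_add)
  moreover have "of_int (f x) *s (c x y *s \<psi> (x - y)) + - ((of_int (f y) * c x y) *s \<psi> (x - y))
      = c x y *s (of_int (f (x - y)) *s \<psi> (x - y))" for y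
    by (simp add: f vec_eq_iff algebra_simps)
  ultimately have "((\<lambda>y. c x y *s (of_int (f (x - y)) *s \<psi> (x - y))) has_sum
      of_int (f x) *s conv c \<psi> x + - conv (\<lambda>x y. of_int (f y) * c x y) \<psi> x) UNIV"
    by simp
  then show "conv c (\<lambda>x. of_int (f x) *s \<psi> x) x
      = ((\<lambda>x. of_int (f x) *s conv c \<psi> x) - conv (\<lambda>x y. of_int (f y) * c x y) \<psi>) x"
    by (subst conv_def) (simp add: infsumI)
qed

definition conv_comp where
  "conv_comp c d = (\<lambda>x z. \<Sum>\<^sub>\<infinity>y. c x y * d (x - y) (z - y))"

lemma summable_on_convolution:
  fixes \<alpha> \<beta> :: "int \<times> int \<Rightarrow> real"
  assumes "\<alpha> summable_on UNIV" "\<beta> summable_on UNIV" "\<And>y. 0 \<le> \<alpha> y" "\<And>y. 0 \<le> \<beta> y"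
  shows "(\<lambda>(z, y). \<alpha> y * \<beta> (z - y)) summable_on UNIV \<times> UNIV"
    "(\<lambda>(y, z). \<alpha> y * \<beta> z) summable_on UNIV \<times> UNIV"
proof -
  show s: "(\<lambda>(y, z). \<alpha> y * \<beta> z) summable_on UNIV \<times> UNIV"
  proof (rule summable_on_SigmaI[where g = "\<lambda>y. \<alpha> y * infsum \<beta> UNIV"])
    show "((\<lambda>z. case (y, z) of (y, z) \<Rightarrow> \<alpha> y * \<beta> z) has_sum \<alpha> y * infsum \<beta> UNIV) UNIV" for y
      using has_sum_cmult_right[OF has_sum_infsum[OF assms(2)]] by simp
    show "(\<lambda>y. \<alpha> y * infsum \<beta> UNIV) summable_on UNIV"
      by (rule summable_on_cmult_left[OF assms(1)])
  qed (auto simp: assms)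
  show "(\<lambda>(z, y). \<alpha> y * \<beta> (z - y)) summable_on UNIV \<times> UNIV"
    using s by (subst summable_on_reindex_bij_witness[where i = "\<lambda>(y, z). (z + y, y)" and j = "\<lambda>(z, y). (y, z - y)"
          and T = "UNIV \<times> UNIV" and h = "\<lambda>(y, z). \<alpha> y * \<beta> z"]) auto
qed

lemma conv_comp_dominated:
  assumes c: "dominated c \<alpha>" and d: "dominated d \<beta>"
  shows "dominated (conv_comp c d) (\<lambda>z. \<Sum>\<^sub>\<infinity>y. \<alpha> y * \<beta> (z - y))"
  unfolding dominated_def
proof (intro conjI allI)
  note s = summable_on_convolution(1)[OF dominatedD(1)[OF c] dominatedD(1)[OF d] dominatedD(3)[OF c] dominatedD(3)[OF d]]
  show "(\<lambda>z. \<Sum>\<^sub>\<infinity>y. \<alpha> y * \<beta> (z - y)) summable_on UNIV"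
    by (rule summable_on_Sigma_banach[OF s])
  fix x z
  show "cmod (conv_comp c d x z) \<le> (\<Sum>\<^sub>\<infinity>y. \<alpha> y * \<beta> (z - y))"
    unfolding conv_comp_def
    by (rule norm_infsum_le[OF has_sum_infsum has_sum_infsum])
      (auto simp: norm_mult intro!: mult_mono dominatedD[OF c] dominatedD[OF d] summable_on_SigmaD1[OF s]
        abs_summable_summable[OF Infinite_Sum.abs_summable_on_comparison_test'[OF summable_on_SigmaD1[OF s, of z]]])
qed

text \<open>Fubini for the double series, which converges absolutely because \<open>\<psi>\<close> is bounded and both
  kernels are dominated.\<close>

lemma conv_conv:
  assumes c: "dominated c \<alpha>" and d: "dominated d \<beta>" and \<psi>: "\<psi> \<in> hilb"
  shows "conv c (conv d \<psi>) = conv (conv_comp c d) \<psi>"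
proof
  fix x
  note nn = dominatedD(3)[OF c] dominatedD(3)[OF d]
  note s = summable_on_convolution[OF dominatedD(1)[OF c] dominatedD(1)[OF d] nn]
  define f where "f z y = (c x y * d (x - y) (z - y)) *s \<psi> (x - z)" for z y
  have "(\<lambda>zy. (case zy of (z, y) \<Rightarrow> \<alpha> y * \<beta> (z - y)) * hnorm \<psi>) summable_on UNIV \<times> UNIV"
    by (rule summable_on_cmult_left[OF s(1)])
  then have "(\<lambda>zy. norm (case zy of (z, y) \<Rightarrow> f z y)) summable_on UNIV \<times> UNIV"
    by (rule Infinite_Sum.abs_summable_on_comparison_test')
      (auto simp: f_def norm_vector_scalar_mult norm_mult
        intro!: mult_mono mult_nonneg_nonneg dominatedD(2)[OF c] dominatedD(2)[OF d] norm_le_hnorm \<psi> nn)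
  then have sf: "(\<lambda>(z, y). f z y) summable_on UNIV \<times> UNIV" by (rule abs_summable_summable)
  have inner: "(\<Sum>\<^sub>\<infinity>z. f z y) = c x y *s conv d \<psi> (x - y)" for y
  proof (rule infsumI)
    have "((\<lambda>z. c x y *s (d (x - y) z *s \<psi> (x - y - z))) has_sum c x y *s conv d \<psi> (x - y)) UNIV"
      by (rule has_sum_bounded_linear[OF bounded_linear_vector_scalar_mult conv_has_sum[OF d \<psi>]])
    then show "((\<lambda>z. f z y) has_sum c x y *s conv d \<psi> (x - y)) UNIV"
      by (subst (asm) has_sum_reindex_bij_witness[where i = "\<lambda>z. z - y" and j = "\<lambda>z. z + y"
            and T = UNIV and h = "\<lambda>z. f z y"]) (auto simp: f_def algebra_simps)
  qed
  have inner': "(\<Sum>\<^sub>\<infinity>y. f z y) = conv_comp c d x z *s \<psi> (x - z)" for z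
  proof (rule infsumI)
    have "(\<lambda>y. c x y * d (x - y) (z - y)) summable_on UNIV"
      by (rule abs_summable_summable[OF Infinite_Sum.abs_summable_on_comparison_test'[OF summable_on_SigmaD1[OF s(1), of z]]])
        (auto simp: norm_mult intro!: mult_mono dominatedD(2)[OF c] dominatedD(2)[OF d] nn)
    then have "((\<lambda>y. c x y * d (x - y) (z - y)) has_sum conv_comp c d x z) UNIV"
      unfolding conv_comp_def by (rule has_sum_infsum)
    moreover have "bounded_linear (\<lambda>k. k *s \<psi> (x - z))"
      by (rule bounded_linear_intro[where K = "norm (\<psi> (x - z))"])
        (auto simp: vec_eq_iff norm_vector_scalar_mult algebra_simps)
    ultimately show "((\<lambda>y. f z y) has_sum conv_comp c d x z *s \<psi> (x - z)) UNIV"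
      unfolding f_def by (rule has_sum_bounded_linear[rotated])
  qed
  have "conv c (conv d \<psi>) x = (\<Sum>\<^sub>\<infinity>y. \<Sum>\<^sub>\<infinity>z. f z y)"
    by (simp add: conv_def[of c] inner)
  also have "\<dots> = (\<Sum>\<^sub>\<infinity>z. \<Sum>\<^sub>\<infinity>y. f z y)"
    by (rule infsum_swap_banach[OF sf, symmetric])
  also have "\<dots> = conv (conv_comp c d) \<psi> x"
    by (simp add: conv_def inner')
  finally show "conv c (conv d \<psi>) x = conv (conv_comp c d) \<psi> x" .
qed

text \<open>Fubini again; the double series is majorised by \<open>\<alpha> y\<close> times the product of \<open>\<phi>\<close> with a
  translate of \<open>\<psi>\<close>, whose sum over \<open>x\<close> is at most \<open>\<alpha> y * (hnorm \<phi> * hnorm \<psi>)\<close> by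
  the Cauchy-Schwarz inequality. The substitution \<open>x \<mapsto> x + y\<close> followed by \<open>y \<mapsto> - y\<close> produces
  the kernel of the adjoint.\<close>

lemma conv_adjoint:
  assumes c: "dominated c \<alpha>" and \<phi>: "\<phi> \<in> hilb" and \<psi>: "\<psi> \<in> hilb"
    and d: "dominated d \<beta>" and dc: "\<And>x y. d x y = cnj (c (x - y) (- y))"
  shows "hinner \<phi> (conv c \<psi>) = hinner (conv d \<phi>) \<psi>"
proof -
  note nn = dominatedD(3)[OF c]
  define f where "f x y = c x y * cdot (\<phi> x) (\<psi> (x - y))" for x y
  define g where "g y x = \<alpha> y * (norm (\<phi> x) * norm (\<psi> (x - y)))" for x y
  have shift: "(\<lambda>x. \<psi> (x - y)) \<in> hilb" "hnorm (\<lambda>x. \<psi> (x - y)) = hnorm \<psi>" for y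
  proof -
    have "(\<lambda>x. (norm (\<psi> (x - y)))\<^sup>2) summable_on UNIV \<longleftrightarrow> (\<lambda>x. (norm (\<psi> x))\<^sup>2) summable_on UNIV"
      by (rule summable_on_reindex_bij_witness[of _ "\<lambda>x. x + y" "\<lambda>x. x - y"]) auto
    then show "(\<lambda>x. \<psi> (x - y)) \<in> hilb" using \<psi> by (simp add: hilb_def)
    have "(\<Sum>\<^sub>\<infinity>x. (norm (\<psi> (x - y)))\<^sup>2) = (\<Sum>\<^sub>\<infinity>x. (norm (\<psi> x))\<^sup>2)"
      by (rule infsum_reindex_bij_witness[of _ "\<lambda>x. x + y" "\<lambda>x. x - y"]) auto
    then show "hnorm (\<lambda>x. \<psi> (x - y)) = hnorm \<psi>" by (simp add: hnorm_def)
  qed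
  have "(\<lambda>(y, x). g y x) summable_on UNIV \<times> UNIV"
  proof (rule summable_on_SigmaI[where g = "\<lambda>y. \<Sum>\<^sub>\<infinity>x. g y x"])
    have gs: "g y summable_on UNIV" for y
      unfolding g_def by (intro summable_on_cmult_right summable_norm_mult \<phi> shift)
    then show "((\<lambda>x. case (y, x) of (y, x) \<Rightarrow> g y x) has_sum (\<Sum>\<^sub>\<infinity>x. g y x)) UNIV" for y by simp
    show "(\<lambda>y. \<Sum>\<^sub>\<infinity>x. g y x) summable_on UNIV"
    proof (rule summable_on_comparison_test)
      show "(\<lambda>y. \<alpha> y * (hnorm \<phi> * hnorm \<psi>)) summable_on UNIV"
        by (rule summable_on_cmult_left[OF dominatedD(1)[OF c]])
      show "(\<Sum>\<^sub>\<infinity>x. g y x) \<le> \<alpha> y * (hnorm \<phi> * hnorm \<psi>)" for y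
        using summable_norm_mult(2)[OF \<phi> shift(1), of y] unfolding g_def shift(2)
        by (subst infsum_cmult_right') (intro mult_left_mono nn)
    qed (auto intro!: infsum_nonneg simp: g_def nn)
  qed (auto simp: g_def nn)
  then have "(\<lambda>yx. norm (case yx of (y, x) \<Rightarrow> f x y)) summable_on UNIV \<times> UNIV"
    by (rule Infinite_Sum.abs_summable_on_comparison_test')
      (auto simp: f_def g_def norm_mult intro!: mult_mono dominatedD(2)[OF c] norm_cdot nn)
  then have sf: "(\<lambda>(y, x). f x y) summable_on UNIV \<times> UNIV" by (rule abs_summable_summable)
  have bl: "bounded_linear (cdot u)" for u
  proof (rule bounded_linear_intro[where K = "norm u"])
    show "cdot u (r *\<^sub>R v) = r *\<^sub>R cdot u v" for r v
      by (simp add: cdot_def scaleR_conv_of_real[where 'a = complex] sum_2 algebra_simps)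
    show "norm (cdot u v) \<le> norm v * norm u" for v
      using norm_cdot[of u v] by (simp add: mult.commute)
  qed (rule cdot_linear)
  have "hinner \<phi> (conv c \<psi>) = (\<Sum>\<^sub>\<infinity>x. \<Sum>\<^sub>\<infinity>y. f x y)"
  proof (unfold hinner_cdot, rule infsum_cong)
    fix x
    have "((\<lambda>y. cdot (\<phi> x) (c x y *s \<psi> (x - y))) has_sum cdot (\<phi> x) (conv c \<psi> x)) UNIV"
      by (rule has_sum_bounded_linear[OF bl conv_has_sum[OF c \<psi>]])
    then show "cdot (\<phi> x) (conv c \<psi> x) = (\<Sum>\<^sub>\<infinity>y. f x y)"
      by (simp add: f_def cdot_linear infsumI)
  qed
  also have "\<dots> = (\<Sum>\<^sub>\<infinity>y. \<Sum>\<^sub>\<infinity>x. f x y)"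
    by (rule infsum_swap_banach[OF sf, symmetric])
  also have "\<dots> = (\<Sum>\<^sub>\<infinity>y. \<Sum>\<^sub>\<infinity>x. f (x + y) y)"
  proof (rule infsum_cong)
    fix y
    show "(\<Sum>\<^sub>\<infinity>x. f x y) = (\<Sum>\<^sub>\<infinity>x. f (x + y) y)"
      by (rule infsum_reindex_bij_witness[of _ "\<lambda>x. x + y" "\<lambda>x. x - y"]) auto
  qed
  also have "\<dots> = (\<Sum>\<^sub>\<infinity>x. \<Sum>\<^sub>\<infinity>y. f (x + y) y)"
  proof (rule infsum_swap_banach)
    show "(\<lambda>(y, x). f (x + y) y) summable_on UNIV \<times> UNIV"
      using sf by (subst summable_on_reindex_bij_witness[where i = "\<lambda>(y, x). (y, x - y)" and j = "\<lambda>(y, x). (y, x + y)"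
            and T = "UNIV \<times> UNIV" and h = "\<lambda>(y, x). f x y"]) auto
  qed
  also have "\<dots> = hinner (conv d \<phi>) \<psi>"
  proof (unfold hinner_cdot, rule infsum_cong)
    fix x
    have "((\<lambda>y. cdot (\<psi> x) (d x y *s \<phi> (x - y))) has_sum cdot (\<psi> x) (conv d \<phi> x)) UNIV"
      by (rule has_sum_bounded_linear[OF bl conv_has_sum[OF d \<phi>]])
    then have "((\<lambda>y. cnj (cdot (\<psi> x) (d x y *s \<phi> (x - y)))) has_sum cnj (cdot (\<psi> x) (conv d \<phi> x))) UNIV"
      by (simp only: has_sum_cnj_iff)
    then have "((\<lambda>y. c (x - y) (- y) * cdot (\<phi> (x - y)) (\<psi> x)) has_sum cdot (conv d \<phi> x) (\<psi> x)) UNIV"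
      by (simp add: cdot_linear cdot_cnj dc)
    then have "((\<lambda>y. f (x + y) y) has_sum cdot (conv d \<phi> x) (\<psi> x)) UNIV"
      by (subst (asm) has_sum_reindex_bij_witness[where i = uminus and j = uminus
            and T = UNIV and h = "\<lambda>y. f (x + y) y"]) (auto simp: f_def)
    then show "(\<Sum>\<^sub>\<infinity>y. f (x + y) y) = cdot (conv d \<phi> x) (\<psi> x)" by (rule infsumI)
  qed
  finally show ?thesis .
qed

section \<open>Left and right multiplication\<close>

lemma phase_mult: "phase \<theta> j * phase \<theta> k = phase \<theta> (j + k)"
  by (simp add: phase_def cis_mult algebra_simps)

lemma phase_zero [simp]: "phase \<theta> 0 = 1"
  by (simp add: phase_def)

lemma phase_cnj: "cnj (phase \<theta> j) = phase \<theta> (- j)"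
  by (simp add: phase_def cis_cnj)

lemma cmod_phase [simp]: "cmod (phase \<theta> j) = 1"
  by (simp add: phase_def)

text \<open>For absolutely summable coefficients the multiplications are bounded, and by Fubini's theorem alone
  they are closed under \<open>mult\<close>.\<close>

definition ell1 :: "coeffs set" where
  "ell1 = {a. (\<lambda>y. cmod (a y)) summable_on UNIV}"

text \<open>The kernels come from \<open>(U\<^sup>p V\<^sup>q) (U\<^sup>r V\<^sup>s) = e(- \<theta> q r) U\<^sup>p\<^sup>+\<^sup>r V\<^sup>q\<^sup>+\<^sup>s\<close>: in
  \<open>lker\<close> the coefficient at \<open>y\<close> is the left factor of this product, in \<open>rker\<close> the right one.\<close>

definition lker :: "real \<Rightarrow> coeffs \<Rightarrow> int \<times> int \<Rightarrow> int \<times> int \<Rightarrow> complex" where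
  "lker \<theta> a x y = phase \<theta> (- (snd y * (fst x - fst y))) * a y"

definition rker :: "real \<Rightarrow> coeffs \<Rightarrow> int \<times> int \<Rightarrow> int \<times> int \<Rightarrow> complex" where
  "rker \<theta> a x y = phase \<theta> (- (fst y * (snd x - snd y))) * a y"

definition rmul :: "real \<Rightarrow> coeffs \<Rightarrow> oper" where
  "rmul \<theta> a = conv (rker \<theta> a)"

lemma dominated_ker:
  assumes "a \<in> ell1"
  shows "dominated (lker \<theta> a) (\<lambda>y. cmod (a y))" "dominated (rker \<theta> a) (\<lambda>y. cmod (a y))"
  using assms by (simp_all add: dominated_def ell1_def lker_def rker_def norm_mult)

lemma lact_conv: "lact \<theta> a = conv (lker \<theta> a)"
proof (intro ext)
  fix \<psi> and x :: "int \<times> int"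
  obtain m n where x: "x = (m, n)" by (cases x)
  show "lact \<theta> a \<psi> x = conv (lker \<theta> a) \<psi> x"
    by (simp add: lact_def conv_def lker_def x case_prod_unfold minus_prod_def)
qed

lemma smooth_ell1:
  assumes "a \<in> smooth"
  shows "a \<in> ell1" "der1 a \<in> ell1" "der2 a \<in> ell1"
proof -
  have *: "c \<in> ell1"
    if "\<And>p q. cmod (c (p, q)) \<le> (1 + \<bar>real_of_int p\<bar> + \<bar>real_of_int q\<bar>) * cmod (a (p, q))" for c :: coeffs
    unfolding ell1_def mem_Collect_eq
    by (rule Infinite_Sum.abs_summable_on_comparison_test'[OF smooth_summable[OF assms]]) (use that in auto)
  show "a \<in> ell1" by (rule *) (simp add: mult_le_cancel_right1)
  show "der1 a \<in> ell1" "der2 a \<in> ell1"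
    by (rule *, auto simp: der1_def der2_def norm_mult intro!: mult_right_mono)+
qed

lemma star_ell1: "a \<in> ell1 \<Longrightarrow> star \<theta> a \<in> ell1"
proof -
  assume a: "a \<in> ell1"
  have "(\<lambda>y. cmod (star \<theta> a y)) summable_on UNIV \<longleftrightarrow> (\<lambda>y. cmod (a y)) summable_on UNIV"
    by (rule summable_on_reindex_bij_witness[of _ uminus uminus]) (auto simp: star_def norm_mult)
  then show ?thesis using a by (simp add: ell1_def)
qed

lemma mult_comp:
  "mult \<theta> a b z = (\<Sum>\<^sub>\<infinity>y. phase \<theta> (- (snd y * (fst z - fst y))) * a y * b (z - y))"
  by (cases z) (simp add: mult_def case_prod_unfold minus_prod_def)

lemma mult_ell1:
  assumes "a \<in> ell1" "b \<in> ell1"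
  shows "mult \<theta> a b \<in> ell1"
proof -
  \<comment> \<open>On the diagonal \<open>x = z\<close>, and with the phase of the second factor switched off, the composed kernel is the product.\<close>
  have *: "conv_comp (lker \<theta> a) (lker 0 b) z z = mult \<theta> a b z" for z
    by (simp add: conv_comp_def mult_comp lker_def phase_def)
  note d = conv_comp_dominated[OF dominated_ker(1)[OF assms(1), of \<theta>] dominated_ker(1)[OF assms(2), of 0]]
  show ?thesis
    unfolding ell1_def mem_Collect_eq
    by (rule Infinite_Sum.abs_summable_on_comparison_test'[OF dominatedD(1)[OF d]])
      (use dominatedD(2)[OF d] * in metis)
qed

text \<open>This and the next two lemmas are associativity of the product, read on the two sides of the
  Hilbert space. Each is an identity between the quadratic exponents of the phases.\<close>

lemma lact_lact:
  assumes "a \<in> ell1" "b \<in> ell1" "\<psi> \<in> hilb"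
  shows "lact \<theta> a (lact \<theta> b \<psi>) = lact \<theta> (mult \<theta> a b) \<psi>"
proof -
  have "conv_comp (lker \<theta> a) (lker \<theta> b) x z = lker \<theta> (mult \<theta> a b) x z" for x z
  proof -
    have "lker \<theta> a x y * lker \<theta> b (x - y) (z - y)
        = phase \<theta> (- (snd z * (fst x - fst z))) * (phase \<theta> (- (snd y * (fst z - fst y))) * a y * b (z - y))" for y
    proof -
      have "phase \<theta> (- (snd y * (fst x - fst y))) * phase \<theta> (- (snd (z - y) * (fst (x - y) - fst (z - y))))
        = phase \<theta> (- (snd z * (fst x - fst z))) * phase \<theta> (- (snd y * (fst z - fst y)))"
        unfolding phase_mult by (rule arg_cong[of _ _ "phase \<theta>"]) (simp add: algebra_simps)
      then show ?thesis by (simp add: lker_def)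
    qed
    then show ?thesis
      by (simp add: conv_comp_def lker_def[of _ "mult \<theta> a b"] mult_comp infsum_cmult_right')
  qed
  then have "conv_comp (lker \<theta> a) (lker \<theta> b) = lker \<theta> (mult \<theta> a b)" by blast
  then show ?thesis
    unfolding lact_conv by (simp only: conv_conv[OF dominated_ker(1)[OF assms(1)] dominated_ker(1)[OF assms(2)] assms(3)])
qed

lemma rmul_rmul:
  assumes "a \<in> ell1" "b \<in> ell1" "\<psi> \<in> hilb"
  shows "rmul \<theta> a (rmul \<theta> b \<psi>) = rmul \<theta> (mult \<theta> b a) \<psi>"
proof -
  have "conv_comp (rker \<theta> a) (rker \<theta> b) x z = rker \<theta> (mult \<theta> b a) x z" for x z
  proof -
    have "rker \<theta> a x (z - y) * rker \<theta> b (x - (z - y)) y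
        = phase \<theta> (- (fst z * (snd x - snd z))) * (phase \<theta> (- (snd y * (fst z - fst y))) * b y * a (z - y))" for y
    proof -
      have "phase \<theta> (- (fst (z - y) * (snd x - snd (z - y)))) * phase \<theta> (- (fst y * (snd (x - (z - y)) - snd y)))
        = phase \<theta> (- (fst z * (snd x - snd z))) * phase \<theta> (- (snd y * (fst z - fst y)))"
        unfolding phase_mult by (rule arg_cong[of _ _ "phase \<theta>"]) (simp add: algebra_simps)
      then show ?thesis by (simp add: rker_def)
    qed
    moreover have "conv_comp (rker \<theta> a) (rker \<theta> b) x z = (\<Sum>\<^sub>\<infinity>y. rker \<theta> a x (z - y) * rker \<theta> b (x - (z - y)) y)"
      unfolding conv_comp_def
      by (rule infsum_reindex_bij_witness[of _ "\<lambda>y. z - y" "\<lambda>y. z - y"]) auto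
    ultimately show ?thesis
      by (simp add: rker_def[of _ "mult \<theta> b a"] mult_comp infsum_cmult_right')
  qed
  then have "conv_comp (rker \<theta> a) (rker \<theta> b) = rker \<theta> (mult \<theta> b a)" by blast
  then show ?thesis
    unfolding rmul_def by (simp only: conv_conv[OF dominated_ker(2)[OF assms(1)] dominated_ker(2)[OF assms(2)] assms(3)])
qed

lemma lact_rmul:
  assumes "a \<in> ell1" "b \<in> ell1" "\<psi> \<in> hilb"
  shows "lact \<theta> a (rmul \<theta> b \<psi>) = rmul \<theta> b (lact \<theta> a \<psi>)"
proof -
  have "conv_comp (lker \<theta> a) (rker \<theta> b) x z = conv_comp (rker \<theta> b) (lker \<theta> a) x z" for x z
    unfolding conv_comp_def
  proof (rule infsum_reindex_bij_witness[of _ "\<lambda>y. z - y" "\<lambda>y. z - y"])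
    fix y
    have "phase \<theta> (- (fst (z - y) * (snd x - snd (z - y)))) *
        phase \<theta> (- (snd (z - (z - y)) * (fst (x - (z - y)) - fst (z - (z - y)))))
      = phase \<theta> (- (snd y * (fst x - fst y))) * phase \<theta> (- (fst (z - y) * (snd (x - y) - snd (z - y))))"
      unfolding phase_mult by (rule arg_cong[of _ _ "phase \<theta>"]) (simp add: algebra_simps)
    then show "rker \<theta> b x (z - y) * lker \<theta> a (x - (z - y)) (z - (z - y)) = lker \<theta> a x y * rker \<theta> b (x - y) (z - y)"
      by (simp add: lker_def rker_def)
  qed auto
  then have "conv_comp (lker \<theta> a) (rker \<theta> b) = conv_comp (rker \<theta> b) (lker \<theta> a)" by blast
  then show ?thesis
    unfolding rmul_def lact_conv
    by (simp only: conv_conv[OF dominated_ker(2)[OF assms(2)] dominated_ker(1)[OF assms(1)] assms(3)]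
        conv_conv[OF dominated_ker(1)[OF assms(1)] dominated_ker(2)[OF assms(2)] assms(3)])
qed

lemma rmul_adjoint:
  assumes "a \<in> ell1" "\<phi> \<in> hilb" "\<psi> \<in> hilb"
  shows "hinner \<phi> (rmul \<theta> a \<psi>) = hinner (rmul \<theta> (star \<theta> a) \<phi>) \<psi>"
  unfolding rmul_def
proof (rule conv_adjoint[OF dominated_ker(2)[OF assms(1)] assms(2,3) dominated_ker(2)[OF star_ell1[OF assms(1)]]])
  fix x y :: "int \<times> int"
  have "phase \<theta> (- (fst y * (snd x - snd y))) * phase \<theta> (- (fst y * snd y))
    = phase \<theta> (- (- (fst (- y) * (snd (x - y) - snd (- y)))))"
    unfolding phase_mult by (rule arg_cong[of _ _ "phase \<theta>"]) (simp add: algebra_simps)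
  then show "rker \<theta> (star \<theta> a) x y = cnj (rker \<theta> a (x - y) (- y))"
    by (simp add: rker_def star_def case_prod_unfold phase_cnj uminus_prod_def mult.assoc[symmetric])
qed

lemma delta_unfold:
  "\<delta>1 \<psi> = (\<lambda>x. of_int (fst x) *s \<psi> x)" "\<delta>2 \<psi> = (\<lambda>x. of_int (snd x) *s \<psi> x)"
  by (auto simp: \<delta>1_def \<delta>2_def)

lemma ker_der:
  "(\<lambda>x y. of_int (fst y) * lker \<theta> a x y) = lker \<theta> (der1 a)" "(\<lambda>x y. of_int (snd y) * lker \<theta> a x y) = lker \<theta> (der2 a)"
  "(\<lambda>x y. of_int (fst y) * rker \<theta> a x y) = rker \<theta> (der1 a)" "(\<lambda>x y. of_int (snd y) * rker \<theta> a x y) = rker \<theta> (der2 a)"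
  by (auto simp: lker_def rker_def der1_def der2_def fun_eq_iff)

lemma Leibniz:
  assumes a: "a \<in> smooth" and \<psi>: "\<psi> \<in> hilb"
  shows "\<delta>1 (lact \<theta> a \<psi>) = lact \<theta> a (\<delta>1 \<psi>) + lact \<theta> (der1 a) \<psi>"
    "\<delta>2 (lact \<theta> a \<psi>) = lact \<theta> a (\<delta>2 \<psi>) + lact \<theta> (der2 a) \<psi>"
    "\<delta>1 (rmul \<theta> a \<psi>) = rmul \<theta> a (\<delta>1 \<psi>) + rmul \<theta> (der1 a) \<psi>"
    "\<delta>2 (rmul \<theta> a \<psi>) = rmul \<theta> a (\<delta>2 \<psi>) + rmul \<theta> (der2 a) \<psi>"
proof -
  note e = smooth_ell1[OF a]
  note d = dominated_ker[OF e(1), of \<theta>] dominated_ker[OF e(2), of \<theta>] dominated_ker[OF e(3), of \<theta>]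
  show "\<delta>1 (lact \<theta> a \<psi>) = lact \<theta> a (\<delta>1 \<psi>) + lact \<theta> (der1 a) \<psi>"
    using conv_Leibniz[OF d(1) d(3)[folded ker_der(1)] \<psi>] by (simp add: lact_conv delta_unfold ker_der)
  show "\<delta>2 (lact \<theta> a \<psi>) = lact \<theta> a (\<delta>2 \<psi>) + lact \<theta> (der2 a) \<psi>"
    using conv_Leibniz[OF d(1) d(5)[folded ker_der(2)] \<psi>] by (simp add: lact_conv delta_unfold ker_der)
  show "\<delta>1 (rmul \<theta> a \<psi>) = rmul \<theta> a (\<delta>1 \<psi>) + rmul \<theta> (der1 a) \<psi>"
    using conv_Leibniz[OF d(2) d(4)[folded ker_der(3)] \<psi>] by (simp add: rmul_def delta_unfold ker_der)
  show "\<delta>2 (rmul \<theta> a \<psi>) = rmul \<theta> a (\<delta>2 \<psi>) + rmul \<theta> (der2 a) \<psi>"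
    using conv_Leibniz[OF d(2) d(6)[folded ker_der(4)] \<psi>] by (simp add: rmul_def delta_unfold ker_der)
qed

lemma mul_hilb:
  assumes "a \<in> ell1" "\<psi> \<in> hilb"
  shows "lact \<theta> a \<psi> \<in> hilb" "rmul \<theta> a \<psi> \<in> hilb"
  unfolding lact_conv rmul_def by (auto intro: conv_hilb dominated_ker assms)

lemma mul_bounded:
  assumes "a \<in> ell1"
  obtains C where "C \<ge> 0" "\<And>\<psi>. \<psi> \<in> hilb \<Longrightarrow> hnorm (lact \<theta> a \<psi>) \<le> C * hnorm \<psi>"
    "\<And>\<psi>. \<psi> \<in> hilb \<Longrightarrow> hnorm (rmul \<theta> a \<psi>) \<le> C * hnorm \<psi>"
proof
  show "(\<Sum>\<^sub>\<infinity>y. cmod (a y)) \<ge> 0" by (rule infsum_nonneg) simp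
qed (unfold lact_conv rmul_def, auto intro: conv_hilb dominated_ker assms)

lemma mul_linear:
  assumes "a \<in> ell1" "\<phi> \<in> hilb" "\<psi> \<in> hilb"
  shows "lact \<theta> a (\<phi> + \<psi>) = lact \<theta> a \<phi> + lact \<theta> a \<psi>" "rmul \<theta> a (\<phi> + \<psi>) = rmul \<theta> a \<phi> + rmul \<theta> a \<psi>"
    "lact \<theta> a (\<phi> - \<psi>) = lact \<theta> a \<phi> - lact \<theta> a \<psi>" "rmul \<theta> a (\<phi> - \<psi>) = rmul \<theta> a \<phi> - rmul \<theta> a \<psi>"
    "lact \<theta> a (scale k \<psi>) = scale k (lact \<theta> a \<psi>)" "rmul \<theta> a (scale k \<psi>) = scale k (rmul \<theta> a \<psi>)"
    "lact \<theta> a (spin M \<psi>) = spin M (lact \<theta> a \<psi>)" "rmul \<theta> a (spin M \<psi>) = spin M (rmul \<theta> a \<psi>)"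
  unfolding lact_conv rmul_def
  using conv_add conv_diff conv_scale conv_spin dominated_ker[OF assms(1)] assms(2,3) by metis+

lemma mul_zero [simp]: "lact \<theta> a 0 = 0" "rmul \<theta> a 0 = 0"
  by (simp_all add: lact_conv rmul_def)

lemma ell1_add: "a \<in> ell1 \<Longrightarrow> b \<in> ell1 \<Longrightarrow> a + b \<in> ell1"
proof -
  assume "a \<in> ell1" "b \<in> ell1"
  then have "(\<lambda>y. cmod (a y) + cmod (b y)) summable_on UNIV"
    unfolding ell1_def by (intro summable_on_add) auto
  then have "(\<lambda>y. norm ((a + b) y)) summable_on UNIV"
    by (rule Infinite_Sum.abs_summable_on_comparison_test') (simp add: norm_triangle_ineq)
  then show ?thesis by (simp add: ell1_def)
qed

lemma ell1_cmult: "a \<in> ell1 \<Longrightarrow> (\<lambda>y. k * a y) \<in> ell1"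
  unfolding ell1_def by (auto simp: norm_mult intro: summable_on_cmult_right)

lemma mul_coeff_linear:
  assumes "a \<in> ell1" "b \<in> ell1" "\<psi> \<in> hilb"
  shows "lact \<theta> (a + b) \<psi> = lact \<theta> a \<psi> + lact \<theta> b \<psi>" "rmul \<theta> (a + b) \<psi> = rmul \<theta> a \<psi> + rmul \<theta> b \<psi>"
    "lact \<theta> (\<lambda>y. k * a y) \<psi> = scale k (lact \<theta> a \<psi>)" "rmul \<theta> (\<lambda>y. k * a y) \<psi> = scale k (rmul \<theta> a \<psi>)"
proof -
  note d = dominated_ker[OF assms(1), of \<theta>] dominated_ker[OF assms(2), of \<theta>]
  have "lker \<theta> (a + b) = (\<lambda>x y. lker \<theta> a x y + lker \<theta> b x y)" "rker \<theta> (a + b) = (\<lambda>x y. rker \<theta> a x y + rker \<theta> b x y)"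
    by (simp_all add: lker_def rker_def fun_eq_iff algebra_simps)
  then show "lact \<theta> (a + b) \<psi> = lact \<theta> a \<psi> + lact \<theta> b \<psi>" "rmul \<theta> (a + b) \<psi> = rmul \<theta> a \<psi> + rmul \<theta> b \<psi>"
    using conv_kernel_add[OF d(1,3) assms(3)] conv_kernel_add[OF d(2,4) assms(3)]
    by (simp_all add: lact_conv rmul_def)
  have "lker \<theta> (\<lambda>y. k * a y) = (\<lambda>x y. k * lker \<theta> a x y)" "rker \<theta> (\<lambda>y. k * a y) = (\<lambda>x y. k * rker \<theta> a x y)"
    by (simp_all add: lker_def rker_def fun_eq_iff)
  then show "lact \<theta> (\<lambda>y. k * a y) \<psi> = scale k (lact \<theta> a \<psi>)" "rmul \<theta> (\<lambda>y. k * a y) \<psi> = scale k (rmul \<theta> a \<psi>)"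
    using conv_kernel_scale[OF d(1) assms(3)] conv_kernel_scale[OF d(2) assms(3)]
    by (simp_all add: lact_conv rmul_def)
qed

lemma mul_coeff_zero: "lact \<theta> 0 \<psi> = 0" "rmul \<theta> 0 \<psi> = 0"
  unfolding lact_conv rmul_def conv_def lker_def rker_def
  by (simp_all only: zero_fun_apply mult_zero_right vector_smult_lzero infsum_0_simp zero_fun_def)

lemma mul_dom_dirac:
  assumes a: "a \<in> smooth" and \<psi>: "\<psi> \<in> dom_dirac"
  shows "lact \<theta> a \<psi> \<in> dom_dirac" "rmul \<theta> a \<psi> \<in> dom_dirac"
  using \<psi> unfolding dom_dirac_def
  by (auto simp: Leibniz[OF a] intro!: hilb_add mul_hilb smooth_ell1[OF a])

text \<open>The spinor component of \<open>J\<close>.\<close>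

definition charge_conj :: "complex ^ 2 \<Rightarrow> complex ^ 2" where
  "charge_conj v = \<i> *s (pauli2 *v (\<chi> i. cnj (v $ i)))"

lemma J_charge_conj: "J \<theta> \<psi> x = phase \<theta> (- (fst x * snd x)) *s charge_conj (\<psi> (- x))"
  by (cases x) (simp add: J_def charge_conj_def)

lemma charge_conj_simps:
  "charge_conj (c *s v) = cnj c *s charge_conj v" "charge_conj (charge_conj v) = - v"
  "charge_conj (pauli3 *v v) = - (pauli3 *v charge_conj v)" "norm (charge_conj v) = norm v"
  by (simp_all add: charge_conj_def vec_eq_iff forall_2 pauli_defs matrix_vector_mult_def sum_2 norm_complex2 norm_mult)

lemma bounded_linear_charge_conj: "bounded_linear charge_conj"
proof (rule bounded_linear_intro[where K = 1])
  show "charge_conj (r *\<^sub>R v) = r *\<^sub>R charge_conj v" for r v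
    by (simp add: charge_conj_def vec_eq_iff forall_2 pauli_defs matrix_vector_mult_def sum_2)
  show "charge_conj (u + v) = charge_conj u + charge_conj v" for u v
    by (simp add: charge_conj_def vec_eq_iff forall_2 pauli_defs matrix_vector_mult_def sum_2 algebra_simps)
qed (simp add: charge_conj_simps)

lemma J_hilb:
  assumes "\<psi> \<in> hilb"
  shows "J \<theta> \<psi> \<in> hilb"
proof -
  have "(\<lambda>x. (norm (J \<theta> \<psi> x))\<^sup>2) summable_on UNIV \<longleftrightarrow> (\<lambda>x. (norm (\<psi> x))\<^sup>2) summable_on UNIV"
    by (rule summable_on_reindex_bij_witness[of _ uminus uminus])
      (auto simp: J_charge_conj norm_vector_scalar_mult charge_conj_simps)
  then show ?thesis using assms by (simp add: hilb_def)
qed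

text \<open>Here the formula for \<open>J\<close> enters: conjugation by \<open>J\<close> turns the left multiplication by
  \<open>a\<^sup>*\<close> into the right multiplication by \<open>a\<close>. The sign is that of \<open>J\<^sup>2 = - 1\<close>.\<close>

lemma J_lact_J:
  assumes a: "a \<in> ell1" and \<psi>: "\<psi> \<in> hilb"
  shows "J \<theta> (lact \<theta> (star \<theta> a) (J \<theta> \<psi>)) = - rmul \<theta> a \<psi>"
proof
  fix x :: "int \<times> int"
  let ?p = "phase \<theta> (- (fst x * snd x))"
  have bl: "bounded_linear (\<lambda>v. ?p *s charge_conj v)"
    by (rule bounded_linear_compose[OF bounded_linear_vector_scalar_mult bounded_linear_charge_conj])
  have "((\<lambda>y. lker \<theta> (star \<theta> a) (- x) y *s J \<theta> \<psi> (- x - y)) has_sum lact \<theta> (star \<theta> a) (J \<theta> \<psi>) (- x)) UNIV"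
    unfolding lact_conv by (rule conv_has_sum[OF dominated_ker(1)[OF star_ell1[OF a]] J_hilb[OF \<psi>]])
  from has_sum_bounded_linear[OF bl this]
  have "((\<lambda>y. ?p *s charge_conj (lker \<theta> (star \<theta> a) (- x) y *s J \<theta> \<psi> (- x - y)))
      has_sum J \<theta> (lact \<theta> (star \<theta> a) (J \<theta> \<psi>)) x) UNIV"
    by (simp only: J_charge_conj[of _ "lact \<theta> (star \<theta> a) (J \<theta> \<psi>)"])
  moreover have "- (rker \<theta> a x (- y) *s \<psi> (x + y)) = ?p *s charge_conj (lker \<theta> (star \<theta> a) (- x) y *s J \<theta> \<psi> (- x - y))" for y
  proof -
    have "?p * phase \<theta> (snd y * (fst (- x) - fst y)) * phase \<theta> (fst y * snd y) * phase \<theta> (fst (- x - y) * snd (- x - y))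
        = phase \<theta> (- (fst (- y) * (snd x - snd (- y))))"
      unfolding phase_mult by (rule arg_cong[of _ _ "phase \<theta>"]) (simp add: algebra_simps)
    moreover have "- (- x - y) = x + y" by simp
    ultimately show ?thesis
      by (simp add: J_charge_conj charge_conj_simps lker_def rker_def star_def case_prod_unfold phase_cnj
          uminus_prod_def[symmetric]) (simp add: mult_ac add.commute)
  qed
  ultimately have "((\<lambda>y. - (rker \<theta> a x (- y) *s \<psi> (x + y))) has_sum J \<theta> (lact \<theta> (star \<theta> a) (J \<theta> \<psi>)) x) UNIV"
    by simp
  then have "((\<lambda>y. - (rker \<theta> a x y *s \<psi> (x - y))) has_sum J \<theta> (lact \<theta> (star \<theta> a) (J \<theta> \<psi>)) x) UNIV"
    by (subst (asm) has_sum_reindex_bij_witness[where i = uminus and j = uminus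
          and T = UNIV and h = "\<lambda>y. - (rker \<theta> a x y *s \<psi> (x - y))"]) auto
  moreover have "((\<lambda>y. - (rker \<theta> a x y *s \<psi> (x - y))) has_sum - rmul \<theta> a \<psi> x) UNIV"
    unfolding rmul_def has_sum_uminus using conv_has_sum[OF dominated_ker(2)[OF a] \<psi>] by simp
  ultimately show "J \<theta> (lact \<theta> (star \<theta> a) (J \<theta> \<psi>)) x = (- rmul \<theta> a \<psi>) x"
    by (simp add: has_sum_unique)
qed

lemma J_minus: "J \<theta> (- \<psi>) = - J \<theta> \<psi>"
  by (rule ext) (simp add: J_charge_conj linear_neg[OF bounded_linear.linear[OF bounded_linear_charge_conj]] vec_eq_iff)

lemma inv_J: "inv (J \<theta>) \<psi> = - J \<theta> \<psi>"
  by (rule inv_f_eq[OF bij_is_inj[OF bij_J]]) (simp add: J_minus J_J)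

lemma lact_minus: "a \<in> ell1 \<Longrightarrow> \<psi> \<in> hilb \<Longrightarrow> lact \<theta> a (- \<psi>) = - lact \<theta> a \<psi>"
  using mul_linear(3)[of a 0 \<psi> \<theta>] by simp

lemma ract_rmul:
  assumes "a \<in> ell1" "\<psi> \<in> hilb"
  shows "ract \<theta> a \<psi> = rmul \<theta> a \<psi>"
  by (simp add: ract_def inv_J lact_minus star_ell1 J_hilb assms J_minus J_lact_J)

lemma J_chirality: "J \<theta> (\<gamma> \<psi>) = - \<gamma> (J \<theta> \<psi>)"
  by (rule ext) (simp add: J_charge_conj charge_conj_simps spin_def vector_scalar_commute)

lemma inv_j0: "inv (j0 \<theta>) \<psi> = - J \<theta> (\<gamma> \<psi>)"
  by (rule inv_f_eq[OF bij_is_inj[OF bij_j0]]) (simp add: j0_def J_minus J_J spin_linear pauli_products)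

text \<open>The operators \<open>\<gamma>\<close> and \<open>J\<close> anticommute, and \<open>\<gamma>\<close> commutes with multiplications, so that \<open>j0\<close>
  and \<open>J\<close> implement the same conjugation. Hence the correction term in the theorem is a right
  multiplication.\<close>

lemma j0_lact:
  assumes "a \<in> ell1" "\<psi> \<in> hilb"
  shows "j0 \<theta> (lact \<theta> (star \<theta> a) (inv (j0 \<theta>) \<psi>)) = rmul \<theta> a \<psi>"
  unfolding inv_j0 unfolding j0_def
  by (simp add: J_chirality mul_linear(7)[where \<phi> = 0] lact_minus hilb_uminus J_minus star_ell1 J_hilb assms J_lact_J
      spin_linear pauli_products)

section \<open>Rellich compactness\<close>

text \<open>The bound on \<open>X\<close> puts all coordinates in a fixed ball, so Tychonoff's theorem yields a
  coordinatewise convergent subsequence. The bounds on \<open>\<delta>1 X\<close> and \<open>\<delta>2 X\<close> make the norm outside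
  the box \<open>{- N..N}\<^sup>2\<close> of order \<open>1 / N\<close> uniformly in the sequence, which upgrades this to
  convergence in norm.\<close>

lemma rellich:
  fixes X :: "nat \<Rightarrow> spinor"
  assumes X: "\<And>n. X n \<in> dom_dirac"
    and K: "\<And>n. hnorm (X n) \<le> K" "\<And>n. hnorm (\<delta>1 (X n)) \<le> K" "\<And>n. hnorm (\<delta>2 (X n)) \<le> K"
  shows "\<exists>\<psi>\<in>hilb. \<exists>r. strict_mono r \<and> (\<lambda>n. hnorm (X (r n) - \<psi>)) \<longlonglongrightarrow> 0"
proof -
  have X': "X n \<in> hilb" "\<delta>1 (X n) \<in> hilb" "\<delta>2 (X n) \<in> hilb" for n
    using X by (auto simp: dom_dirac_def)
  have K0: "K \<ge> 0" by (rule order_trans[OF hnorm_nonneg K(1)[of 0]])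
  define S where "S = PiE UNIV (\<lambda>_ :: int \<times> int. cball (0 :: complex ^ 2) K)"
  have "compactin (product_topology (\<lambda>_. euclidean) UNIV) S"
    unfolding S_def compactin_PiE by simp
  then have "compact S" by (simp add: euclidean_product_topology)
  then have "seq_compact S" by (rule compact_imp_seq_compact)
  moreover have "\<forall>n. X n \<in> S"
    using order_trans[OF norm_le_hnorm[OF X'(1)] K(1)] by (simp add: S_def PiE_UNIV_domain Pi_def)
  ultimately obtain l r where r: "strict_mono r" and l: "(X \<circ> r) \<longlonglongrightarrow> l"
    by (rule seq_compactE)
  have lim: "(\<lambda>n. X (r n) x) \<longlonglongrightarrow> l x" for x
    using continuous_on_tendsto_compose[OF continuous_on_product_coordinates l] by simp
  have lim1: "(\<lambda>n. \<delta>1 (X (r n)) x) \<longlonglongrightarrow> \<delta>1 l x" and lim2: "(\<lambda>n. \<delta>2 (X (r n)) x) \<longlonglongrightarrow> \<delta>2 l x" for x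
    unfolding delta_unfold by (rule bounded_linear.tendsto[OF bounded_linear_vector_scalar_mult lim])+
  have bound: "\<psi> \<in> hilb \<and> hnorm \<psi> \<le> K"
    if "\<And>x. (\<lambda>n. Y n x) \<longlonglongrightarrow> \<psi> x" "\<And>n. Y n \<in> hilb" "\<And>n. hnorm (Y n) \<le> K" for Y \<psi>
  proof -
    have "L2_set (\<lambda>x. norm (\<psi> x)) F \<le> K" for F
    proof (rule tendsto_upperbound)
      show "(\<lambda>n. L2_set (\<lambda>x. norm (Y n x)) F) \<longlonglongrightarrow> L2_set (\<lambda>x. norm (\<psi> x)) F"
        unfolding L2_set_def by (intro tendsto_intros that(1))
      show "\<forall>\<^sub>F n in sequentially. L2_set (\<lambda>x. norm (Y n x)) F \<le> K"
        using order_trans[OF L2_set_le_hnorm[OF that(2)] that(3)] by simp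
    qed simp
    then show ?thesis using hilb_hnorm_leI[OF K0, of \<psi>] by simp
  qed
  have l: "l \<in> hilb" "\<delta>1 l \<in> hilb" "\<delta>2 l \<in> hilb" "hnorm l \<le> K" "hnorm (\<delta>1 l) \<le> K" "hnorm (\<delta>2 l) \<le> K"
    using bound[OF lim X'(1) K(1)] bound[OF lim1 X'(2) K(2)] bound[OF lim2 X'(3) K(3)] by auto
  define Y where "Y n = X (r n) - l" for n
  define B :: "nat \<Rightarrow> (int \<times> int) set" where "B N = {- int N..int N} \<times> {- int N..int N}" for N
  have Y: "hnorm (\<delta>1 (Y n)) \<le> 2 * K" "hnorm (\<delta>2 (Y n)) \<le> 2 * K" "\<delta>1 (Y n) \<in> hilb" "\<delta>2 (Y n) \<in> hilb" for n
    unfolding Y_def delta_linear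
    using hilb_diff[OF X'(2)[of "r n"] l(2)] hilb_diff[OF X'(3)[of "r n"] l(3)] K(2,3)[of "r n"] l by auto
  have main: "hnorm (Y n) \<le> L2_set (\<lambda>x. norm (Y n x)) (B N) + 4 * K / real N" if N: "N > 0" for n N
  proof (rule hilb_hnorm_leI(2))
    show "0 \<le> L2_set (\<lambda>x. norm (Y n x)) (B N) + 4 * K / real N" using K0 by simp
    fix F :: "(int \<times> int) set" assume F: "finite F"
    \<comment> \<open>Outside the box one of the two coordinates exceeds \<open>N\<close> in absolute value.\<close>
    have pt: "norm (Y n x) \<le> (if x \<in> B N then norm (Y n x) else 0)
        + (1 / real N * norm (\<delta>1 (Y n) x) + 1 / real N * norm (\<delta>2 (Y n) x))" for x
    proof (cases "x \<in> B N")
      case False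
      then have "real N \<le> \<bar>of_int (fst x)\<bar> + \<bar>real_of_int (snd x)\<bar>"
        unfolding B_def by (cases x) auto
      then have "real N * norm (Y n x) \<le> (\<bar>of_int (fst x)\<bar> + \<bar>real_of_int (snd x)\<bar>) * norm (Y n x)"
        by (rule mult_right_mono) simp
      then have "real N * norm (Y n x) \<le> norm (\<delta>1 (Y n) x) + norm (\<delta>2 (Y n) x)"
        by (simp add: delta_unfold norm_vector_scalar_mult distrib_right)
      then show ?thesis using False N by (simp add: field_simps)
    qed simp
    have distrib: "1 / real N * L2_set f F = L2_set (\<lambda>x. 1 / real N * f x) F" for f
      by (rule L2_set_right_distrib) simp
    have "L2_set (\<lambda>x. norm (Y n x)) F \<le> L2_set (\<lambda>x. (if x \<in> B N then norm (Y n x) else 0)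
        + (1 / real N * norm (\<delta>1 (Y n) x) + 1 / real N * norm (\<delta>2 (Y n) x))) F"
      using pt by (intro L2_set_mono) auto
    also have "\<dots> \<le> L2_set (\<lambda>x. if x \<in> B N then norm (Y n x) else 0) F
        + (1 / real N * L2_set (\<lambda>x. norm (\<delta>1 (Y n) x)) F + 1 / real N * L2_set (\<lambda>x. norm (\<delta>2 (Y n) x)) F)"
      by (rule order_trans[OF L2_set_triangle_ineq add_left_mono[OF order_trans[OF L2_set_triangle_ineq]]])
        (simp only: distrib order_refl)
    also have "L2_set (\<lambda>x. if x \<in> B N then norm (Y n x) else 0) F \<le> L2_set (\<lambda>x. norm (Y n x)) (B N)"
    proof -
      have "(\<Sum>x\<in>F. (if x \<in> B N then norm (Y n x) else 0)\<^sup>2) = (\<Sum>x\<in>F \<inter> B N. (norm (Y n x))\<^sup>2)"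
        unfolding sum.inter_restrict[OF F] by (rule sum.cong) auto
      also have "\<dots> \<le> (\<Sum>x\<in>B N. (norm (Y n x))\<^sup>2)"
        by (rule sum_mono2) (auto simp: B_def)
      finally show ?thesis by (simp add: L2_set_def)
    qed
    also have "1 / real N * L2_set (\<lambda>x. norm (\<delta>1 (Y n) x)) F \<le> 1 / real N * (2 * K)"
      by (rule mult_left_mono[OF order_trans[OF L2_set_le_hnorm[OF Y(3)] Y(1)]]) simp
    also have "1 / real N * L2_set (\<lambda>x. norm (\<delta>2 (Y n) x)) F \<le> 1 / real N * (2 * K)"
      by (rule mult_left_mono[OF order_trans[OF L2_set_le_hnorm[OF Y(4)] Y(2)]]) simp
    finally show "L2_set (\<lambda>x. norm (Y n x)) F \<le> L2_set (\<lambda>x. norm (Y n x)) (B N) + 4 * K / real N"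
      by simp
  qed
  have "(\<lambda>n. hnorm (Y n)) \<longlonglongrightarrow> 0"
  proof (rule tendstoI)
    fix e :: real assume e: "e > 0"
    obtain N :: nat where N: "N > 0" "4 * K / e * 2 < real N"
      using reals_Archimedean2[of "max 0 (4 * K / e * 2)"] by (auto simp: max_less_iff_conj)
    have "4 * K / real N < e / 2" using N e by (simp add: field_simps)
    have "(\<lambda>n. Y n x) \<longlonglongrightarrow> 0" for x
      using tendsto_diff[OF lim tendsto_const[of "l x"], of x] by (simp add: Y_def)
    then have "(\<lambda>n. L2_set (\<lambda>x. norm (Y n x)) (B N)) \<longlonglongrightarrow> L2_set (\<lambda>x. norm (0 :: complex ^ 2)) (B N)"
      unfolding L2_set_def by (intro tendsto_intros)
    then have "(\<lambda>n. L2_set (\<lambda>x. norm (Y n x)) (B N)) \<longlonglongrightarrow> 0" by (simp add: L2_set_def)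
    then have "\<forall>\<^sub>F n in sequentially. L2_set (\<lambda>x. norm (Y n x)) (B N) < e / 2"
      by (rule order_tendstoD) (use e in simp)
    then show "\<forall>\<^sub>F n in sequentially. dist (hnorm (Y n)) 0 < e"
    proof eventually_elim
      case (elim n)
      then show ?case using main[OF N(1), of n] \<open>4 * K / real N < e / 2\<close> by simp
    qed
  qed
  then show ?thesis using l(1) r by (auto simp: Y_def)
qed

section \<open>The twisted operator\<close>

text \<open>The operator \<open>\<delta>1 - w \<delta>2\<close>, with \<open>w\<close> acting from the right, is the derivative along the base
  lifted horizontally by the connection with coefficient \<open>w\<close>. The operator of the theorem agrees
  with \<open>twist\<close> on its domain (lemma \<open>dirac_minus_twist\<close>).\<close>

definition covariant :: "real \<Rightarrow> coeffs \<Rightarrow> oper" where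
  "covariant \<theta> w \<psi> = \<delta>1 \<psi> - rmul \<theta> w (\<delta>2 \<psi>)"

definition twist :: "real \<Rightarrow> coeffs \<Rightarrow> oper" where
  "twist \<theta> w \<psi> = \<sigma>1 (covariant \<theta> w \<psi>) + \<sigma>2 (\<delta>2 \<psi>)"

lemma base_smooth: "w \<in> base \<Longrightarrow> w \<in> smooth" "w \<in> base \<Longrightarrow> der2 w = 0"
  by (auto simp: base_def alg_weight_def fun_eq_iff)

text \<open>Elements of the base have weight zero, so they commute with \<open>\<delta>2\<close>; this holds formally on all of
  \<open>hilb\<close>.\<close>

lemma delta2_rmul_base:
  assumes "w \<in> base" "\<psi> \<in> hilb"
  shows "\<delta>2 (rmul \<theta> w \<psi>) = rmul \<theta> w (\<delta>2 \<psi>)"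
  by (simp add: Leibniz base_smooth assms mul_coeff_zero)

lemma dom_diracD: "\<psi> \<in> dom_dirac \<Longrightarrow> \<psi> \<in> hilb" "\<psi> \<in> dom_dirac \<Longrightarrow> \<delta>1 \<psi> \<in> hilb" "\<psi> \<in> dom_dirac \<Longrightarrow> \<delta>2 \<psi> \<in> hilb"
  by (auto simp: dom_dirac_def)

lemma base_ell1: "w \<in> base \<Longrightarrow> w \<in> ell1"
  by (rule smooth_ell1(1)[OF base_smooth(1)])

lemma covariant_hilb:
  assumes "w \<in> base" "\<psi> \<in> dom_dirac"
  shows "covariant \<theta> w \<psi> \<in> hilb"
  unfolding covariant_def
  by (rule hilb_diff(1)[OF dom_diracD(2)[OF assms(2)] mul_hilb(2)[OF base_ell1[OF assms(1)] dom_diracD(3)[OF assms(2)]]])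

lemma twist_hilb:
  assumes "w \<in> base" "\<psi> \<in> dom_dirac"
  shows "twist \<theta> w \<psi> \<in> hilb"
  unfolding twist_def
  by (rule hilb_add(1)[OF hilb_pauli(1)[OF covariant_hilb[OF assms]] hilb_pauli(2)[OF dom_diracD(3)[OF assms(2)]]])

text \<open>The cross term is \<open>2 Re (i \<langle>A \<psi>, \<gamma> \<delta>2 \<psi>\<rangle>)\<close> for \<open>A = covariant \<theta> w\<close>. It vanishes
  because \<open>A\<close>, \<open>\<gamma>\<close> and \<open>\<delta>2\<close> are symmetric and commute, which makes the inner product real. The
  two parts of \<open>A\<close> are treated separately, as \<open>\<psi>\<close> need not be in the domain of \<open>A \<delta>2\<close>. The
  identity is an elliptic estimate: however large \<open>w\<close> is, the graph norm of \<open>twist\<close> controls that of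
  \<open>\<delta>2\<close>, hence also that of \<open>\<delta>1\<close>.\<close>

lemma twist_norm:
  assumes w: "w \<in> base" "star \<theta> w = w" and \<psi>: "\<psi> \<in> dom_dirac"
  shows "(hnorm (twist \<theta> w \<psi>))\<^sup>2 = (hnorm (covariant \<theta> w \<psi>))\<^sup>2 + (hnorm (\<delta>2 \<psi>))\<^sup>2"
proof -
  note d = dom_diracD[OF \<psi>] and e = base_ell1[OF w(1)]
  have R: "rmul \<theta> w (\<delta>2 \<psi>) \<in> hilb" by (intro mul_hilb d e)
  have 1: "cnj (hinner (\<delta>1 \<psi>) (\<gamma> (\<delta>2 \<psi>))) = hinner (\<delta>1 \<psi>) (\<gamma> (\<delta>2 \<psi>))"
  proof -
    have "cnj (cdot (\<delta>1 \<psi> x) (\<gamma> (\<delta>2 \<psi>) x)) = cdot (\<delta>1 \<psi> x) (\<gamma> (\<delta>2 \<psi>) x)" for x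
      unfolding cdot_cnj by (simp add: delta_unfold spin_def vector_scalar_commute cdot_linear cdot_pauli mult_ac)
    then show ?thesis unfolding hinner_cdot infsum_cnj[symmetric] by simp
  qed
  have 2: "cnj (hinner (rmul \<theta> w (\<delta>2 \<psi>)) (\<gamma> (\<delta>2 \<psi>))) = hinner (rmul \<theta> w (\<delta>2 \<psi>)) (\<gamma> (\<delta>2 \<psi>))"
  proof -
    have "cnj (hinner (rmul \<theta> w (\<delta>2 \<psi>)) (\<gamma> (\<delta>2 \<psi>))) = hinner (\<gamma> (\<delta>2 \<psi>)) (rmul \<theta> w (\<delta>2 \<psi>))"
      by (rule hinner_cnj)
    also have "\<dots> = hinner (rmul \<theta> w (\<gamma> (\<delta>2 \<psi>))) (\<delta>2 \<psi>)"
      by (simp add: rmul_adjoint e d w)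
    also have "\<dots> = hinner (rmul \<theta> w (\<delta>2 \<psi>)) (\<gamma> (\<delta>2 \<psi>))"
      by (simp add: mul_linear(8)[OF e d(3) d(3)] hinner_pauli)
    finally show ?thesis .
  qed
  have "hinner (\<sigma>1 (covariant \<theta> w \<psi>)) (\<sigma>2 (\<delta>2 \<psi>)) = hinner (covariant \<theta> w \<psi>) (\<sigma>1 (\<sigma>2 (\<delta>2 \<psi>)))"
    by (simp add: hinner_pauli(1))
  also have "\<dots> = \<i> * (hinner (\<delta>1 \<psi>) (\<gamma> (\<delta>2 \<psi>)) - hinner (rmul \<theta> w (\<delta>2 \<psi>)) (\<gamma> (\<delta>2 \<psi>)))"
    by (simp add: pauli_products hinner_scale covariant_def hinner_linear d R)
  finally have "hinner (\<sigma>1 (covariant \<theta> w \<psi>)) (\<sigma>2 (\<delta>2 \<psi>))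
    = \<i> * (hinner (\<delta>1 \<psi>) (\<gamma> (\<delta>2 \<psi>)) - hinner (rmul \<theta> w (\<delta>2 \<psi>)) (\<gamma> (\<delta>2 \<psi>)))" .
  moreover have "Im (hinner (\<delta>1 \<psi>) (\<gamma> (\<delta>2 \<psi>))) = 0" "Im (hinner (rmul \<theta> w (\<delta>2 \<psi>)) (\<gamma> (\<delta>2 \<psi>))) = 0"
    using arg_cong[OF 1, of Im] arg_cong[OF 2, of Im] by simp_all
  ultimately have "Re (hinner (\<sigma>1 (covariant \<theta> w \<psi>)) (\<sigma>2 (\<delta>2 \<psi>))) = 0" by simp
  then show ?thesis
    unfolding twist_def by (simp add: hnorm_add_sq covariant_hilb w \<psi> d)
qed

lemma twist_bounds:
  assumes w: "w \<in> base" "star \<theta> w = w" and \<psi>: "\<psi> \<in> dom_dirac"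
  shows "hnorm (covariant \<theta> w \<psi>) \<le> hnorm (twist \<theta> w \<psi>)" "hnorm (\<delta>2 \<psi>) \<le> hnorm (twist \<theta> w \<psi>)"
  by (rule power2_le_imp_le; simp add: twist_norm[OF assms])+

lemma twist_symmetric:
  assumes w: "w \<in> base" "star \<theta> w = w" and \<phi>: "\<phi> \<in> dom_dirac" and \<psi>: "\<psi> \<in> dom_dirac"
  shows "hinner \<phi> (twist \<theta> w \<psi>) = hinner (twist \<theta> w \<phi>) \<psi>"
proof -
  note d = dom_diracD[OF \<phi>] dom_diracD[OF \<psi>] and e = base_ell1[OF w(1)]
  have R: "rmul \<theta> w (\<delta>2 \<psi>) \<in> hilb" "rmul \<theta> w (\<delta>2 \<phi>) \<in> hilb" by (intro mul_hilb d e)+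
  have "hinner (\<sigma>1 \<phi>) (rmul \<theta> w (\<delta>2 \<psi>)) = hinner (rmul \<theta> w (\<sigma>1 \<phi>)) (\<delta>2 \<psi>)"
    by (simp add: rmul_adjoint e d w)
  also have "\<dots> = hinner (\<sigma>1 (\<delta>2 (rmul \<theta> w \<phi>))) \<psi>"
    by (simp add: mul_linear(8)[OF e d(1) d(1)] hinner_delta delta_linear)
  also have "\<dots> = hinner (\<sigma>1 (rmul \<theta> w (\<delta>2 \<phi>))) \<psi>"
    by (simp add: delta2_rmul_base w d)
  finally have *: "hinner (\<sigma>1 \<phi>) (rmul \<theta> w (\<delta>2 \<psi>)) = hinner (\<sigma>1 (rmul \<theta> w (\<delta>2 \<phi>))) \<psi>" .
  have "hinner \<phi> (twist \<theta> w \<psi>) = hinner (\<sigma>1 \<phi>) (\<delta>1 \<psi>) - hinner (\<sigma>1 \<phi>) (rmul \<theta> w (\<delta>2 \<psi>)) + hinner (\<sigma>2 \<phi>) (\<delta>2 \<psi>)"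
    by (simp add: twist_def covariant_def spin_linear hinner_linear hilb_diff d R hinner_pauli)
  also have "\<dots> = hinner (\<sigma>1 (\<delta>1 \<phi>)) \<psi> - hinner (\<sigma>1 (rmul \<theta> w (\<delta>2 \<phi>))) \<psi> + hinner (\<sigma>2 (\<delta>2 \<phi>)) \<psi>"
    by (simp add: * hinner_delta delta_linear)
  also have "\<dots> = hinner (twist \<theta> w \<phi>) \<psi>"
    by (simp add: twist_def covariant_def spin_linear hinner_linear hilb_diff d R)
  finally show ?thesis .
qed

text \<open>The spectral projection of \<open>\<delta>2\<close> onto \<open>{- N..N}\<close>. It commutes with all operators of interest
  and makes \<open>\<delta>2\<close> bounded.\<close>

definition trunc :: "nat \<Rightarrow> oper" where
  "trunc N \<psi> = (\<lambda>x. if \<bar>snd x\<bar> \<le> int N then \<psi> x else 0)"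

lemma trunc_commute:
  "\<delta>1 (trunc N \<psi>) = trunc N (\<delta>1 \<psi>)" "\<delta>2 (trunc N \<psi>) = trunc N (\<delta>2 \<psi>)"
  "spin M (trunc N \<psi>) = trunc N (spin M \<psi>)" "trunc N (\<phi> + \<psi>) = trunc N \<phi> + trunc N \<psi>"
  "trunc N (\<phi> - \<psi>) = trunc N \<phi> - trunc N \<psi>"
  by (auto simp: trunc_def delta_unfold spin_def fun_eq_iff)

lemma trunc_rmul:
  assumes "w \<in> base"
  shows "rmul \<theta> w (trunc N \<psi>) = trunc N (rmul \<theta> w \<psi>)"
proof
  fix x :: "int \<times> int"
  have w: "w y = 0" if "snd y \<noteq> 0" for y
    using fun_cong[OF base_smooth(2)[OF assms], of y] that by (cases y) (simp add: der2_def)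
  have "rker \<theta> w x y *s trunc N \<psi> (x - y)
      = (if \<bar>snd x\<bar> \<le> int N then rker \<theta> w x y *s \<psi> (x - y) else 0)" for y
    by (cases "snd y = 0") (simp_all add: trunc_def rker_def w)
  then show "rmul \<theta> w (trunc N \<psi>) x = trunc N (rmul \<theta> w \<psi>) x"
    by (simp add: rmul_def conv_def trunc_def)
qed

lemma trunc_hilb:
  assumes "\<psi> \<in> hilb"
  shows "trunc N \<psi> \<in> hilb" "hnorm (trunc N \<psi>) \<le> hnorm \<psi>" "\<delta>2 (trunc N \<psi>) \<in> hilb"
proof -
  have 1: "norm (trunc N \<psi> x) \<le> 1 * norm (\<psi> x)" and 2: "norm (\<delta>2 (trunc N \<psi>) x) \<le> real N * norm (\<psi> x)" for x
    by (auto simp: trunc_def delta_unfold norm_vector_scalar_mult intro!: mult_right_mono)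
  show "trunc N \<psi> \<in> hilb" "hnorm (trunc N \<psi>) \<le> hnorm \<psi>"
    using hilb_dominated[OF assms 1] by auto
  show "\<delta>2 (trunc N \<psi>) \<in> hilb" using hilb_dominated(1)[OF assms 2] by simp
qed

text \<open>Tested against the unit vectors, the adjoint is the formal expression of the operator. There
  \<open>\<delta>2 (rmul \<theta> w \<phi>)\<close> stands for \<open>rmul \<theta> w (\<delta>2 \<phi>)\<close>, because \<open>\<delta>2 \<phi>\<close> is not yet
  known to be square summable and the series of the latter might not converge.\<close>

lemma twist_adjoint_formula:
  assumes w: "w \<in> base" "star \<theta> w = w" and \<phi>: "\<phi> \<in> hilb"
    and adj: "\<And>\<psi>. \<psi> \<in> dom_dirac \<Longrightarrow> hinner \<phi> (twist \<theta> w \<psi>) = hinner \<eta> \<psi>"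
  shows "\<eta> = \<sigma>1 (\<delta>1 \<phi> - \<delta>2 (rmul \<theta> w \<phi>)) + \<sigma>2 (\<delta>2 \<phi>)"
proof
  fix x :: "int \<times> int"
  obtain m n where x: "x = (m, n)" by (cases x)
  have e: "w \<in> ell1" by (rule base_ell1[OF w(1)])
  show "\<eta> x = (\<sigma>1 (\<delta>1 \<phi> - \<delta>2 (rmul \<theta> w \<phi>)) + \<sigma>2 (\<delta>2 \<phi>)) x"
  proof (rule cdot_eqI)
    fix v
    let ?e = "unit_at x v"
    have u: "?e \<in> hilb" "?e \<in> dom_dirac" using finite_support_hilb finite_support_dom_dirac by auto
    have R: "rmul \<theta> w ?e \<in> hilb" by (intro mul_hilb e u)
    have "cdot (\<eta> x) v = hinner \<phi> (twist \<theta> w ?e)"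
      using adj[OF u(2)] by (simp add: hinner_unit)
    also have "\<dots> = hinner (\<sigma>1 \<phi>) (\<delta>1 ?e) - hinner (\<sigma>1 \<phi>) (rmul \<theta> w (\<delta>2 ?e)) + hinner (\<sigma>2 \<phi>) (\<delta>2 ?e)"
      by (simp add: twist_def covariant_def x delta_unit spin_linear hinner_linear hilb_diff u[unfolded x] R[unfolded x]
          hinner_pauli hinner_scale mul_linear(6)[OF e u(1) u(1), unfolded x] \<phi>)
    also have "\<dots> = of_int m * cdot (\<sigma>1 \<phi> x) v - of_int n * cdot (rmul \<theta> w (\<sigma>1 \<phi>) x) v + of_int n * cdot (\<sigma>2 \<phi> x) v"
      using rmul_adjoint[OF e hilb_pauli(1)[OF \<phi>] u(1), of \<theta>]
      by (simp add: x delta_unit hinner_scale hinner_unit mul_linear(6)[OF e u(1) u(1), unfolded x] w)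
    also have "\<dots> = cdot ((\<sigma>1 (\<delta>1 \<phi> - \<delta>2 (rmul \<theta> w \<phi>)) + \<sigma>2 (\<delta>2 \<phi>)) x) v"
      by (simp add: mul_linear(8)[OF e \<phi> \<phi>] x delta_unfold spin_linear cdot_linear)
        (simp add: spin_def vector_scalar_commute cdot_linear)
    finally show "cdot (\<eta> x) v = cdot ((\<sigma>1 (\<delta>1 \<phi> - \<delta>2 (rmul \<theta> w \<phi>)) + \<sigma>2 (\<delta>2 \<phi>)) x) v" .
  qed
qed

text \<open>After truncation \<open>\<phi>\<close> lies in the domain: \<open>\<delta>2\<close> has become bounded and the equation can be solved
  for \<open>\<delta>1\<close>. The norm identity then bounds \<open>\<delta>2 (trunc N \<phi>)\<close> by \<open>\<eta>\<close>, independently of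
  \<open>N\<close>, so \<open>\<delta>2 \<phi>\<close> is square summable, and the equation gives the same for \<open>\<delta>1 \<phi>\<close>.\<close>

lemma twist_adjoint_domain:
  assumes w: "w \<in> base" "star \<theta> w = w" and \<phi>: "\<phi> \<in> hilb" and \<eta>: "\<eta> \<in> hilb"
    and eq: "\<eta> = \<sigma>1 (\<delta>1 \<phi> - \<delta>2 (rmul \<theta> w \<phi>)) + \<sigma>2 (\<delta>2 \<phi>)"
  shows "\<phi> \<in> dom_dirac" "twist \<theta> w \<phi> = \<eta>"
proof -
  have e: "w \<in> ell1" by (rule base_ell1[OF w(1)])
  have solve: "\<delta>1 \<phi> = \<sigma>1 \<eta> - \<sigma>1 (\<sigma>2 (\<delta>2 \<phi>)) + \<delta>2 (rmul \<theta> w \<phi>)"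
    unfolding eq spin_linear pauli_products(1) by (simp add: spin_linear)
  have "hnorm (\<delta>2 (trunc N \<phi>)) \<le> hnorm \<eta>" for N
  proof -
    note t = trunc_hilb[OF \<phi>, of N]
    have "\<delta>1 (trunc N \<phi>) = \<sigma>1 (trunc N \<eta>) - \<sigma>1 (\<sigma>2 (\<delta>2 (trunc N \<phi>))) + \<delta>2 (trunc N (rmul \<theta> w \<phi>))"
      unfolding trunc_commute using arg_cong[OF solve, of "trunc N"] by (simp only: trunc_commute)
    then have "\<delta>1 (trunc N \<phi>) \<in> hilb"
      by (simp only:) (intro hilb_add hilb_diff hilb_pauli trunc_hilb \<phi> \<eta> mul_hilb e)
    then have dom: "trunc N \<phi> \<in> dom_dirac" using t by (simp add: dom_dirac_def)
    have "twist \<theta> w (trunc N \<phi>) = \<sigma>1 (\<delta>1 (trunc N \<phi>) - \<delta>2 (rmul \<theta> w (trunc N \<phi>))) + \<sigma>2 (\<delta>2 (trunc N \<phi>))"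
      by (simp only: twist_def covariant_def delta2_rmul_base[OF w(1) t(1)])
    also have "\<dots> = trunc N \<eta>"
      by (subst eq) (simp only: trunc_commute spin_linear trunc_rmul[OF w(1)])
    finally have tw: "twist \<theta> w (trunc N \<phi>) = trunc N \<eta>" .
    show ?thesis
      by (rule order_trans[OF twist_bounds(2)[OF w dom, unfolded tw] trunc_hilb(2)[OF \<eta>]])
  qed
  note b = this
  have "\<delta>2 \<phi> \<in> hilb"
  proof (rule hilb_hnorm_leI(1)[OF hnorm_nonneg])
    fix F :: "(int \<times> int) set" assume F: "finite F"
    \<comment> \<open>The truncation level is chosen so that nothing is cut off on \<open>F\<close>; \<open>0\<close> is inserted to cover the empty set.\<close>
    define N where "N = nat (Max (insert 0 ((\<lambda>x. \<bar>snd x\<bar>) ` F)))"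
    have N: "\<bar>snd x\<bar> \<le> int N" if "x \<in> F" for x
    proof -
      have "\<bar>snd x\<bar> \<le> Max (insert 0 ((\<lambda>x. \<bar>snd x\<bar>) ` F))" using F that by (intro Max_ge) auto
      then show ?thesis unfolding N_def by linarith
    qed
    have "L2_set (\<lambda>x. norm (\<delta>2 \<phi> x)) F = L2_set (\<lambda>x. norm (\<delta>2 (trunc N \<phi>) x)) F"
      by (rule L2_set_cong) (simp_all add: trunc_def delta_unfold N)
    also have "\<dots> \<le> hnorm \<eta>"
      by (rule order_trans[OF L2_set_le_hnorm[OF trunc_hilb(3)[OF \<phi>]] b])
    finally show "L2_set (\<lambda>x. norm (\<delta>2 \<phi> x)) F \<le> hnorm \<eta>" .
  qed
  moreover have "\<delta>2 (rmul \<theta> w \<phi>) = rmul \<theta> w (\<delta>2 \<phi>)" by (rule delta2_rmul_base[OF w(1) \<phi>])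
  ultimately have "\<delta>1 \<phi> \<in> hilb"
    by (subst solve) (simp add: hilb_add hilb_diff \<eta> mul_hilb e)
  with \<open>\<delta>2 \<phi> \<in> hilb\<close> \<phi> show "\<phi> \<in> dom_dirac" by (simp add: dom_dirac_def)
  show "twist \<theta> w \<phi> = \<eta>"
    by (subst eq) (simp only: twist_def covariant_def delta2_rmul_base[OF w(1) \<phi>])
qed

lemma dense_dom_dirac: "dense_in_hilb dom_dirac"
  using finite_support_dense finite_support_dom_dirac unfolding dense_in_hilb_def dom_dirac_def
  by blast

lemma twist_selfadjoint:
  assumes w: "w \<in> base" "star \<theta> w = w" and T: "\<And>\<psi>. \<psi> \<in> dom_dirac \<Longrightarrow> T \<psi> = twist \<theta> w \<psi>"
  shows "selfadjoint_op dom_dirac T"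
  unfolding selfadjoint_op_def
proof (intro conjI dense_dom_dirac set_eqI iffI)
  fix p assume "p \<in> adjoint_graph dom_dirac T"
  then obtain \<phi> \<eta> where p: "p = (\<phi>, \<eta>)" "\<phi> \<in> hilb" "\<eta> \<in> hilb"
    and adj: "\<And>\<psi>. \<psi> \<in> dom_dirac \<Longrightarrow> hinner \<phi> (twist \<theta> w \<psi>) = hinner \<eta> \<psi>"
    by (auto simp: adjoint_graph_def T)
  note d = twist_adjoint_domain[OF w p(2,3) twist_adjoint_formula[OF w p(2) adj]]
  then show "p \<in> op_graph dom_dirac T" unfolding p(1) op_graph_def using T[OF d(1)] by auto
next
  fix p assume "p \<in> op_graph dom_dirac T"
  then show "p \<in> adjoint_graph dom_dirac T"
    by (auto simp: op_graph_def adjoint_graph_def T dom_diracD twist_hilb twist_symmetric w)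
qed

text \<open>Left and right multiplications commute, so the commutator of \<open>a\<close> with the correction term only
  involves \<open>[\<delta>2, a]\<close> and the unbounded operator \<open>\<delta>2\<close> disappears.\<close>

lemma twist_bounded_commutators:
  assumes w: "w \<in> base" and T: "\<And>\<psi>. \<psi> \<in> dom_dirac \<Longrightarrow> T \<psi> = twist \<theta> w \<psi>"
  shows "bounded_commutators \<theta> dom_dirac T"
  unfolding bounded_commutators_def
proof (intro ballI conjI)
  fix a assume a: "a \<in> smooth"
  note e = smooth_ell1[OF a] and ew = base_ell1[OF w(1)]
  show "lact \<theta> a \<psi> \<in> dom_dirac" if "\<psi> \<in> dom_dirac" for \<psi> by (rule mul_dom_dirac(1)[OF a that])
  obtain C1 where C1: "C1 \<ge> 0" "\<And>\<psi>. \<psi> \<in> hilb \<Longrightarrow> hnorm (lact \<theta> (der1 a) \<psi>) \<le> C1 * hnorm \<psi>"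
    using mul_bounded[OF e(2)] by metis
  obtain C2 where C2: "C2 \<ge> 0" "\<And>\<psi>. \<psi> \<in> hilb \<Longrightarrow> hnorm (lact \<theta> (der2 a) \<psi>) \<le> C2 * hnorm \<psi>"
    using mul_bounded[OF e(3)] by metis
  obtain C where C: "C \<ge> 0" "\<And>\<psi>. \<psi> \<in> hilb \<Longrightarrow> hnorm (rmul \<theta> w \<psi>) \<le> C * hnorm \<psi>"
    using mul_bounded[OF ew] by metis
  have "hnorm (comm T (lact \<theta> a) \<psi>) \<le> (C1 + C * C2 + C2) * hnorm \<psi>" if \<psi>: "\<psi> \<in> dom_dirac" for \<psi>
  proof -
    note d = dom_diracD[OF \<psi>]
    have h: "lact \<theta> (der1 a) \<psi> \<in> hilb" "lact \<theta> (der2 a) \<psi> \<in> hilb" "rmul \<theta> w (lact \<theta> (der2 a) \<psi>) \<in> hilb"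
      "rmul \<theta> w (\<delta>2 \<psi>) \<in> hilb" "lact \<theta> a (\<delta>2 \<psi>) \<in> hilb"
      by (intro mul_hilb e ew d)+
    have l: "lact \<theta> a (spin M \<zeta>) = spin M (lact \<theta> a \<zeta>)" if "\<zeta> \<in> hilb" for M \<zeta>
      by (rule mul_linear(7)[OF e(1) that that])
    have "lact \<theta> a (twist \<theta> w \<psi>) = \<sigma>1 (lact \<theta> a (\<delta>1 \<psi>) - rmul \<theta> w (lact \<theta> a (\<delta>2 \<psi>))) + \<sigma>2 (lact \<theta> a (\<delta>2 \<psi>))"
      unfolding twist_def covariant_def
      by (simp add: mul_linear(1,3) l e ew d h hilb_diff lact_rmul)
    moreover have "twist \<theta> w (lact \<theta> a \<psi>) = \<sigma>1 (lact \<theta> a (\<delta>1 \<psi>) + lact \<theta> (der1 a) \<psi>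
        - (rmul \<theta> w (lact \<theta> a (\<delta>2 \<psi>)) + rmul \<theta> w (lact \<theta> (der2 a) \<psi>))) + \<sigma>2 (lact \<theta> a (\<delta>2 \<psi>) + lact \<theta> (der2 a) \<psi>)"
      unfolding twist_def covariant_def by (simp add: Leibniz a d h mul_linear(2)[OF ew])
    ultimately have "comm T (lact \<theta> a) \<psi> = \<sigma>1 (lact \<theta> (der1 a) \<psi> - rmul \<theta> w (lact \<theta> (der2 a) \<psi>)) + \<sigma>2 (lact \<theta> (der2 a) \<psi>)"
      unfolding comm_def T[OF \<psi>] T[OF mul_dom_dirac(1)[OF a \<psi>]] by (simp add: spin_linear)
    then have "hnorm (comm T (lact \<theta> a) \<psi>)
        \<le> hnorm (lact \<theta> (der1 a) \<psi> - rmul \<theta> w (lact \<theta> (der2 a) \<psi>)) + hnorm (lact \<theta> (der2 a) \<psi>)"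
      using hilb_add(2)[OF hilb_pauli(1)[OF hilb_diff(1)[OF h(1,3)]] hilb_pauli(2)[OF h(2)]]
      by (simp only: hnorm_pauli)
    also have "hnorm (lact \<theta> (der1 a) \<psi> - rmul \<theta> w (lact \<theta> (der2 a) \<psi>))
        \<le> hnorm (lact \<theta> (der1 a) \<psi>) + hnorm (rmul \<theta> w (lact \<theta> (der2 a) \<psi>))"
      by (rule hilb_diff(2)[OF h(1,3)])
    also have "hnorm (rmul \<theta> w (lact \<theta> (der2 a) \<psi>)) \<le> C * (C2 * hnorm \<psi>)"
      by (rule order_trans[OF C(2)[OF h(2)] mult_left_mono[OF C2(2)[OF d(1)] C(1)]])
    finally show ?thesis
      using C1(2)[OF d(1)] C2(2)[OF d(1)] unfolding distrib_right mult.assoc by linarith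
  qed
  then show "\<exists>C. \<forall>\<psi>\<in>dom_dirac. hnorm (comm T (lact \<theta> a) \<psi>) \<le> C * hnorm \<psi>" by blast
qed

text \<open>For symmetric \<open>T\<close> the vectors \<open>(T - Re z) \<psi>\<close> and \<open>i Im z \<psi>\<close> are orthogonal with respect to
  the real part of the inner product.\<close>

lemma twist_resolvent_bound:
  assumes w: "w \<in> base" "star \<theta> w = w" and \<psi>: "\<psi> \<in> dom_dirac"
  shows "\<bar>Im z\<bar> * hnorm \<psi> \<le> hnorm (twist \<theta> w \<psi> - scale z \<psi>)"
proof -
  define Y where "Y = twist \<theta> w \<psi> - scale (Re z) \<psi>"
  note d = dom_diracD[OF \<psi>] twist_hilb[OF w(1) \<psi>]
  have Y: "Y \<in> hilb" unfolding Y_def by (intro hilb_diff hilb_scale d)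
  have split: "scale z \<psi> = scale (Re z) \<psi> + scale (\<i> * Im z) \<psi>"
    unfolding scale_linear(3)[symmetric] complex_eq[symmetric] ..
  have neg: "scale (- (\<i> * Im z)) \<psi> = - scale (\<i> * Im z) \<psi>"
    by (rule ext) (simp add: scale_def vec_eq_iff)
  have eq: "twist \<theta> w \<psi> - scale z \<psi> = Y + scale (- (\<i> * Im z)) \<psi>"
    unfolding Y_def split neg by (simp only: diff_conv_add_uminus minus_add_distrib add.assoc)
  have "cnj (hinner (twist \<theta> w \<psi>) \<psi>) = hinner (twist \<theta> w \<psi>) \<psi>"
    by (simp add: hinner_cnj twist_symmetric w \<psi>)
  then have "Im (hinner (twist \<theta> w \<psi>) \<psi>) = 0" by (simp add: complex_eq_iff)
  then have "Im (hinner Y \<psi>) = 0"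
    unfolding Y_def hinner_linear(3)[OF d(4) hilb_scale[OF d(1)] d(1)] hinner_scale hinner_self[OF d(1)]
    by simp
  then have "Re (hinner Y (scale (- (\<i> * Im z)) \<psi>)) = 0" by (simp add: hinner_scale)
  then have "(hnorm (twist \<theta> w \<psi> - scale z \<psi>))\<^sup>2 = (hnorm Y)\<^sup>2 + (hnorm (scale (- (\<i> * Im z)) \<psi>))\<^sup>2"
    unfolding eq hnorm_add_sq[OF Y hilb_scale[OF d(1)]] by simp
  moreover have "(hnorm (scale (- (\<i> * Im z)) \<psi>))\<^sup>2 = (\<bar>Im z\<bar> * hnorm \<psi>)\<^sup>2"
    by (simp add: hnorm_sq scale_def norm_vector_scalar_mult norm_mult power_mult_distrib infsum_cmult_right')
  ultimately show ?thesis
    by (intro power2_le_imp_le[OF _ hnorm_nonneg]) (simp only: le_add_same_cancel2 zero_le_power2)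
qed

lemma twist_compact_resolvent:
  assumes w: "w \<in> base" "star \<theta> w = w" and T: "\<And>\<psi>. \<psi> \<in> dom_dirac \<Longrightarrow> T \<psi> = twist \<theta> w \<psi>"
  shows "compact_resolvent dom_dirac T"
  unfolding compact_resolvent_def
proof (intro allI impI)
  fix z and X :: "nat \<Rightarrow> spinor"
  assume z: "Im z \<noteq> 0" and X': "\<forall>n. X n \<in> dom_dirac \<and> hnorm (T (X n) - scale z (X n)) \<le> 1"
  then have X: "X n \<in> dom_dirac" for n by simp
  have le: "hnorm (twist \<theta> w (X n) - scale z (X n)) \<le> 1" for n
    using X' T[OF X[of n]] by metis
  obtain C where C: "C \<ge> 0" "\<And>\<psi>. \<psi> \<in> hilb \<Longrightarrow> hnorm (rmul \<theta> w \<psi>) \<le> C * hnorm \<psi>"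
    using mul_bounded[OF base_ell1[OF w(1)]] by metis
  define L where "L = 1 / \<bar>Im z\<bar>"
  define M where "M = 1 + cmod z * L"
  have L: "hnorm (X n) \<le> L" for n
    using order_trans[OF twist_resolvent_bound[OF w X] le, of n] z
    by (simp add: L_def pos_le_divide_eq mult.commute)
  have M: "hnorm (twist \<theta> w (X n)) \<le> M" for n
  proof -
    note d = dom_diracD[OF X[of n]] twist_hilb[OF w(1) X[of n]]
    have "hnorm (twist \<theta> w (X n)) = hnorm ((twist \<theta> w (X n) - scale z (X n)) + scale z (X n))" by simp
    also have "\<dots> \<le> hnorm (twist \<theta> w (X n) - scale z (X n)) + hnorm (scale z (X n))"
      by (intro hilb_add hilb_diff hilb_scale d)
    also have "hnorm (scale z (X n)) \<le> cmod z * L"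
      by (rule order_trans[OF hnorm_scale_le[OF d(1)] mult_left_mono[OF L]]) simp
    finally show ?thesis unfolding M_def using le[of n] by linarith
  qed
  note b = order_trans[OF twist_bounds(1)[OF w X] M] order_trans[OF twist_bounds(2)[OF w X] M]
  have D1: "hnorm (\<delta>1 (X n)) \<le> M + C * M" for n
  proof -
    note d = dom_diracD[OF X[of n]]
    have "hnorm (\<delta>1 (X n)) = hnorm (covariant \<theta> w (X n) + rmul \<theta> w (\<delta>2 (X n)))" by (simp add: covariant_def)
    also have "\<dots> \<le> hnorm (covariant \<theta> w (X n)) + hnorm (rmul \<theta> w (\<delta>2 (X n)))"
      by (intro hilb_add covariant_hilb w X mul_hilb smooth_ell1 base_smooth d)
    also have "hnorm (rmul \<theta> w (\<delta>2 (X n))) \<le> C * M"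
      by (rule order_trans[OF C(2)[OF d(3)] mult_left_mono[OF b(2) C(1)]])
    finally show ?thesis using b(1)[of n] by simp
  qed
  have "M \<ge> 0" by (rule order_trans[OF hnorm_nonneg M[of 0]])
  then have "hnorm (X n) \<le> L + M + C * M" "hnorm (\<delta>1 (X n)) \<le> L + M + C * M" "hnorm (\<delta>2 (X n)) \<le> L + M + C * M" for n
    using L[of n] D1[of n] b(2)[of n] C(1) mult_nonneg_nonneg[OF C(1), of M] order_trans[OF hnorm_nonneg L[of n]]
    by linarith+
  from rellich[OF X this] show "\<exists>\<psi>\<in>hilb. \<exists>r. strict_mono r \<and> (\<lambda>n. hnorm (X (r n) - \<psi>)) \<longlonglongrightarrow> 0" .
qed

section \<open>Horizontal parts\<close>

text \<open>The map \<open>T \<mapsto> \<Gamma> [\<Gamma>, T] / 2\<close> keeps the part of \<open>T\<close> that anticommutes with \<open>\<Gamma> = \<sigma>2\<close>.\<close>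

lemma horizontal_clifford:
  assumes "T \<psi> = \<sigma>1 \<phi> + \<sigma>2 \<eta>" "T (\<sigma>2 \<psi>) = \<sigma>1 (\<sigma>2 \<phi>) + \<sigma>2 (\<sigma>2 \<eta>)"
  shows "horizontal T \<psi> = \<sigma>1 \<phi>"
proof
  fix x
  show "horizontal T \<psi> x = \<sigma>1 \<phi> x"
    unfolding horizontal_def comm_def assms
    by (simp add: spin_def scale_def vec_eq_iff forall_2 pauli_defs matrix_vector_mult_def sum_2 algebra_simps)
qed

lemma horizontal_dirac: "horizontal dirac \<psi> = \<sigma>1 (\<delta>1 \<psi>)"
  by (rule horizontal_clifford) (simp_all only: dirac_def delta_linear)

lemma dom_dirac_spin:
  assumes "\<psi> \<in> dom_dirac"
  shows "\<sigma>2 \<psi> \<in> dom_dirac"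
  using assms by (simp add: dom_dirac_def delta_linear)

lemma horizontal_dom_dirac: "horizontal_dom dom_dirac = dom_dirac"
  by (auto simp: horizontal_dom_def dom_dirac_spin)

lemma horizontal_twist:
  assumes w: "w \<in> base" and \<psi>: "\<psi> \<in> dom_dirac" and T: "\<And>\<psi>. \<psi> \<in> dom_dirac \<Longrightarrow> T \<psi> = twist \<theta> w \<psi>"
  shows "horizontal T \<psi> = \<sigma>1 (covariant \<theta> w \<psi>)"
proof (rule horizontal_clifford)
  show "T \<psi> = \<sigma>1 (covariant \<theta> w \<psi>) + \<sigma>2 (\<delta>2 \<psi>)"
    unfolding T[OF \<psi>] twist_def ..
  have "covariant \<theta> w (\<sigma>2 \<psi>) = \<sigma>2 (covariant \<theta> w \<psi>)"
    unfolding covariant_def delta_linear spin_linear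
      mul_linear(8)[OF base_ell1[OF w] dom_diracD(3)[OF \<psi>] dom_diracD(3)[OF \<psi>]] ..
  then show "T (\<sigma>2 \<psi>) = \<sigma>1 (\<sigma>2 (covariant \<theta> w \<psi>)) + \<sigma>2 (\<sigma>2 (\<delta>2 \<psi>))"
    unfolding T[OF dom_dirac_spin[OF \<psi>]] twist_def by (simp only: delta_linear)
qed

lemma dirac_minus_twist:
  assumes w: "w \<in> base" "star \<theta> w = w" and \<psi>: "\<psi> \<in> dom_dirac"
  shows "dirac \<psi> - \<sigma>1 (j0 \<theta> (lact \<theta> w (inv (j0 \<theta>) (\<delta>2 \<psi>)))) = twist \<theta> w \<psi>"
proof -
  have "j0 \<theta> (lact \<theta> w (inv (j0 \<theta>) (\<delta>2 \<psi>))) = rmul \<theta> w (\<delta>2 \<psi>)"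
    using j0_lact[OF base_ell1[OF w(1)] dom_diracD(3)[OF \<psi>], of \<theta>] unfolding w(2) .
  then show ?thesis
    unfolding dirac_def twist_def covariant_def by (simp only: spin_linear diff_add_eq)
qed

section \<open>One-forms\<close>

text \<open>Over the base only \<open>\<delta>1\<close> contributes to \<open>[D, b]\<close>, so that \<open>\<Sum> b' [D, b] a\<close> is \<open>\<sigma>1\<close> times the
  left multiplication by this element.\<close>

definition form_coeff :: "real \<Rightarrow> (coeffs \<times> coeffs \<times> coeffs) list \<Rightarrow> coeffs" where
  "form_coeff \<theta> ts = (\<Sum>(b', b, a)\<leftarrow>ts. mult \<theta> b' (mult \<theta> (der1 b) a))"

lemma form_coeff_ell1:
  assumes "set ts \<subseteq> base \<times> base \<times> smooth"
  shows "form_coeff \<theta> ts \<in> ell1"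
  using assms
proof (induction ts)
  case Nil
  then show ?case by (simp add: form_coeff_def ell1_def)
next
  case (Cons t ts)
  obtain b' b a where t: "t = (b', b, a)" by (cases t)
  have "mult \<theta> b' (mult \<theta> (der1 b) a) \<in> ell1"
    using Cons.prems unfolding t
    by (simp add: mult_ell1 base_ell1 smooth_ell1 base_smooth)
  moreover have "form_coeff \<theta> ts \<in> ell1" using Cons by simp
  ultimately show ?case by (simp only: form_coeff_def list.map sum_list.Cons t prod.case ell1_add)
qed

lemma form_alg_op_coeff:
  assumes "set ts \<subseteq> base \<times> base \<times> smooth" and \<psi>: "\<psi> \<in> hilb"
  shows "form_alg_op \<theta> ts \<psi> = \<sigma>1 (lact \<theta> (form_coeff \<theta> ts) \<psi>)"
  using assms(1)
proof (induction ts)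
  case Nil
  then show ?case by (simp only: form_alg_op_def form_coeff_def list.map sum_list.Nil mul_coeff_zero spin_linear)
next
  case (Cons t ts)
  obtain b' b a where t: "t = (b', b, a)" by (cases t)
  then have b': "b' \<in> base" and b: "b \<in> base" and a: "a \<in> smooth" using Cons.prems by auto
  note e = base_ell1[OF b'] smooth_ell1(2)[OF base_smooth(1)[OF b]] smooth_ell1(1)[OF a]
  let ?c = "mult \<theta> b' (mult \<theta> (der1 b) a)"
  have h: "lact \<theta> a \<psi> \<in> hilb" "lact \<theta> (der1 b) (lact \<theta> a \<psi>) \<in> hilb" by (intro mul_hilb e \<psi>)+
  have "comm dirac (lact \<theta> b) (lact \<theta> a \<psi>) = \<sigma>1 (lact \<theta> (der1 b) (lact \<theta> a \<psi>))"
    unfolding comm_dirac_lact[OF base_smooth(1)[OF b] h(1)] base_smooth(2)[OF b] mul_coeff_zero spin_linear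
    by (rule add_0_right)
  then have head: "lact \<theta> b' (comm dirac (lact \<theta> b) (lact \<theta> a \<psi>)) = \<sigma>1 (lact \<theta> ?c \<psi>)"
    by (simp only: mul_linear(7)[OF e(1) h(2) h(2), unfolded lact_lact[OF e(2,3) \<psi>]] lact_lact[OF e(2,3) \<psi>] lact_lact[OF e(1) mult_ell1[OF e(2,3)] \<psi>])
  have ts: "set ts \<subseteq> base \<times> base \<times> smooth" using Cons.prems by simp
  have "form_alg_op \<theta> (t # ts) \<psi> = \<sigma>1 (lact \<theta> ?c \<psi>) + \<sigma>1 (lact \<theta> (form_coeff \<theta> ts) \<psi>)"
    using Cons.IH[OF ts] head by (simp only: form_alg_op_def list.map sum_list.Cons t prod.case)
  also have "\<dots> = \<sigma>1 (lact \<theta> (?c + form_coeff \<theta> ts) \<psi>)"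
    by (simp only: spin_linear mul_coeff_linear(1)[OF mult_ell1[OF e(1) mult_ell1[OF e(2,3)]] form_coeff_ell1[OF ts] \<psi>])
  finally show ?case by (simp only: form_coeff_def list.map sum_list.Cons t prod.case)
qed

lemma comm_dirac_ract:
  assumes b: "b \<in> base" and \<psi>: "\<psi> \<in> dom_dirac"
  shows "comm dirac (ract \<theta> b) \<psi> = \<sigma>1 (rmul \<theta> (der1 b) \<psi>)"
proof -
  note d = dom_diracD[OF \<psi>] and e = base_ell1[OF b]
  have "ract \<theta> b (dirac \<psi>) = \<sigma>1 (rmul \<theta> b (\<delta>1 \<psi>)) + \<sigma>2 (rmul \<theta> b (\<delta>2 \<psi>))"
    unfolding dirac_def ract_rmul[OF e hilb_add(1)[OF hilb_pauli(1)[OF d(2)] hilb_pauli(2)[OF d(3)]]]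
    by (simp only: mul_linear(2)[OF e hilb_pauli(1)[OF d(2)] hilb_pauli(2)[OF d(3)]]
        mul_linear(8)[OF e d(2) d(2)] mul_linear(8)[OF e d(3) d(3)])
  moreover have "dirac (ract \<theta> b \<psi>) = \<sigma>1 (rmul \<theta> b (\<delta>1 \<psi>) + rmul \<theta> (der1 b) \<psi>) + \<sigma>2 (rmul \<theta> b (\<delta>2 \<psi>))"
    unfolding dirac_def ract_rmul[OF e d(1)] Leibniz(3)[OF base_smooth(1)[OF b] d(1)] delta2_rmul_base[OF b d(1)] ..
  ultimately show ?thesis
    unfolding comm_def by (simp only: spin_linear) simp
qed

text \<open>The right action is given by the same coefficient as the left one in \<open>form_alg_op_coeff\<close>. As left
  multiplication is faithful, a presentation of a form enters only through the operator that it
  represents.\<close>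

lemma right_form_op_coeff:
  assumes "set ts \<subseteq> base \<times> base \<times> smooth" and h: "h \<in> dom_dirac"
  shows "right_form_op \<theta> ts h = \<sigma>1 (rmul \<theta> (form_coeff \<theta> ts) h)"
  using assms(1)
proof (induction ts)
  case Nil
  then show ?case by (simp only: right_form_op_def form_coeff_def list.map sum_list.Nil mul_coeff_zero spin_linear)
next
  case (Cons t ts)
  obtain b' b a where t: "t = (b', b, a)" by (cases t)
  then have b': "b' \<in> base" and b: "b \<in> base" and a: "a \<in> smooth" using Cons.prems by auto
  note e = base_ell1[OF b'] smooth_ell1(2)[OF base_smooth(1)[OF b]] smooth_ell1(1)[OF a]
  note \<psi> = dom_diracD(1)[OF h]
  let ?c = "mult \<theta> b' (mult \<theta> (der1 b) a)"
  have h': "rmul \<theta> b' h \<in> hilb" "rmul \<theta> (der1 b) (rmul \<theta> b' h) \<in> hilb" by (intro mul_hilb e \<psi>)+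
  have "comm dirac (ract \<theta> b) (ract \<theta> b' h) = \<sigma>1 (rmul \<theta> (der1 b) (rmul \<theta> b' h))"
    unfolding ract_rmul[OF e(1) \<psi>] by (rule comm_dirac_ract[OF b mul_dom_dirac(2)[OF base_smooth(1)[OF b'] h]])
  then have head: "ract \<theta> a (comm dirac (ract \<theta> b) (ract \<theta> b' h)) = \<sigma>1 (rmul \<theta> ?c h)"
    by (simp only: ract_rmul[OF e(3) hilb_pauli(1)[OF h'(2)]] mul_linear(8)[OF e(3) h'(2) h'(2)]
        rmul_rmul[OF e(3) e(2) h'(1)] rmul_rmul[OF mult_ell1[OF e(2,3)] e(1) \<psi>])
  have ts: "set ts \<subseteq> base \<times> base \<times> smooth" using Cons.prems by simp
  have "right_form_op \<theta> (t # ts) h = \<sigma>1 (rmul \<theta> ?c h) + \<sigma>1 (rmul \<theta> (form_coeff \<theta> ts) h)"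
    using Cons.IH[OF ts] head by (simp only: right_form_op_def list.map sum_list.Cons t prod.case)
  also have "\<dots> = \<sigma>1 (rmul \<theta> (?c + form_coeff \<theta> ts) h)"
    by (simp only: spin_linear mul_coeff_linear(2)[OF mult_ell1[OF e(1) mult_ell1[OF e(2,3)]] form_coeff_ell1[OF ts] \<psi>])
  finally show ?case by (simp only: form_coeff_def list.map sum_list.Cons t prod.case)
qed

text \<open>The vector at the origin is the cyclic vector of the GNS representation, which separates
  the algebra.\<close>

lemma lact_unit: "lact \<theta> c (unit_at 0 v) x = c x *s v"
proof -
  have "lact \<theta> c (unit_at 0 v) x = (\<Sum>\<^sub>\<infinity>y\<in>{x}. lker \<theta> c x y *s unit_at 0 v (x - y))"
    unfolding lact_conv conv_def by (rule infsum_cong_neutral) (simp_all add: unit_at_def)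
  then show ?thesis by (simp add: lker_def unit_at_def)
qed

lemma lact_faithful:
  assumes "\<And>\<psi>. \<psi> \<in> hilb \<Longrightarrow> lact \<theta> c \<psi> = lact \<theta> d \<psi>"
  shows "c = d"
proof
  fix x
  have "lact \<theta> c (unit_at 0 1) x = lact \<theta> d (unit_at 0 1) x"
    by (rule arg_cong[OF assms[OF subsetD[OF finite_support_hilb finite_support_unit]], of "\<lambda>\<psi>. \<psi> x"])
  then show "c x = d x" by (simp add: lact_unit vec_eq_iff)
qed

text \<open>Up to the factor \<open>\<sigma>1\<close> this is \<open>\<nabla>\<^sub>\<omega> a\<close>: the terms with \<open>\<sigma>2\<close> in \<open>[D, a]\<close> and
  \<open>\<delta>2(a) \<omega>\<close> cancel.\<close>

definition nabla_coeff :: "real \<Rightarrow> coeffs \<Rightarrow> coeffs \<Rightarrow> coeffs" where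
  "nabla_coeff \<theta> w a = der1 a + (\<lambda>y. - 1 * mult \<theta> (der2 a) w y)"

lemma nabla_coeff:
  assumes w: "w \<in> base" and a: "a \<in> smooth"
  shows "nabla_coeff \<theta> w a \<in> ell1"
    "\<psi> \<in> hilb \<Longrightarrow> nabla \<theta> (\<lambda>\<psi>. \<sigma>2 \<psi> + \<sigma>1 (lact \<theta> w \<psi>)) a \<psi> = \<sigma>1 (lact \<theta> (nabla_coeff \<theta> w a) \<psi>)"
    "h \<in> hilb \<Longrightarrow> rmul \<theta> (nabla_coeff \<theta> w a) h = rmul \<theta> (der1 a) h - rmul \<theta> w (rmul \<theta> (der2 a) h)"
proof -
  note e = smooth_ell1[OF a] base_ell1[OF w]
  note m = mult_ell1[OF e(3,4), of \<theta>]
  note m' = ell1_cmult[OF m, of "- 1"]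
  show "nabla_coeff \<theta> w a \<in> ell1" unfolding nabla_coeff_def by (rule ell1_add[OF e(2) m'])
  have neg: "scale (- 1) \<zeta> = - \<zeta>" for \<zeta> by (rule ext) (simp add: scale_def vec_eq_iff)
  show "rmul \<theta> (nabla_coeff \<theta> w a) h = rmul \<theta> (der1 a) h - rmul \<theta> w (rmul \<theta> (der2 a) h)" if h: "h \<in> hilb" for h
    unfolding nabla_coeff_def
    by (simp only: mul_coeff_linear(2)[OF e(2) m' h] mul_coeff_linear(4)[OF m m h] neg rmul_rmul[OF e(4,3) h]
        diff_conv_add_uminus)
  assume \<psi>: "\<psi> \<in> hilb"
  have h: "lact \<theta> w \<psi> \<in> hilb" by (rule mul_hilb(1)[OF e(4) \<psi>])
  have "lact \<theta> (der2 a) (\<sigma>2 \<psi> + \<sigma>1 (lact \<theta> w \<psi>)) = \<sigma>2 (lact \<theta> (der2 a) \<psi>) + \<sigma>1 (lact \<theta> (mult \<theta> (der2 a) w) \<psi>)"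
    by (simp only: mul_linear(1)[OF e(3) hilb_pauli(2)[OF \<psi>] hilb_pauli(1)[OF h]]
        mul_linear(7)[OF e(3) \<psi> \<psi>] mul_linear(7)[OF e(3) h h] lact_lact[OF e(3,4) \<psi>])
  moreover have "\<sigma>1 (lact \<theta> (nabla_coeff \<theta> w a) \<psi>) = \<sigma>1 (lact \<theta> (der1 a) \<psi>) - \<sigma>1 (lact \<theta> (mult \<theta> (der2 a) w) \<psi>)"
    unfolding nabla_coeff_def
    by (simp only: mul_coeff_linear(1)[OF e(2) m' \<psi>] mul_coeff_linear(3)[OF m m \<psi>] neg spin_linear
        diff_conv_add_uminus)
  ultimately show "nabla \<theta> (\<lambda>\<psi>. \<sigma>2 \<psi> + \<sigma>1 (lact \<theta> w \<psi>)) a \<psi> = \<sigma>1 (lact \<theta> (nabla_coeff \<theta> w a) \<psi>)"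
    unfolding nabla_def comm_dirac_lact[OF a \<psi>] by simp
qed

lemma form_coeff_nabla:
  assumes w: "w \<in> base" and a: "a \<in> smooth" and ts: "set ts \<subseteq> base \<times> base \<times> smooth"
    and eq: "eq_on_hilb (nabla \<theta> (\<lambda>\<psi>. \<sigma>2 \<psi> + \<sigma>1 (lact \<theta> w \<psi>)) a) (form_alg_op \<theta> ts)"
  shows "form_coeff \<theta> ts = nabla_coeff \<theta> w a"
proof (rule lact_faithful)
  fix \<psi> assume \<psi>: "\<psi> \<in> hilb"
  have "\<sigma>1 (lact \<theta> (form_coeff \<theta> ts) \<psi>) = \<sigma>1 (lact \<theta> (nabla_coeff \<theta> w a) \<psi>)"
    using eq \<psi> by (simp only: eq_on_hilb_def form_alg_op_coeff[OF ts \<psi>, symmetric] nabla_coeff(2)[OF w a \<psi>, symmetric])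
  then show "lact \<theta> (form_coeff \<theta> ts) \<psi> = lact \<theta> (nabla_coeff \<theta> w a) \<psi>"
    by (metis pauli_products(1))
qed

section \<open>The twisted Dirac operator\<close>

lemma covariant_add:
  assumes "w \<in> base" "\<phi> \<in> dom_dirac" "\<psi> \<in> dom_dirac"
  shows "covariant \<theta> w (\<phi> + \<psi>) = covariant \<theta> w \<phi> + covariant \<theta> w \<psi>"
  unfolding covariant_def
  by (simp only: delta_linear mul_linear(2)[OF base_ell1[OF assms(1)] dom_diracD(3)[OF assms(2)] dom_diracD(3)[OF assms(3)]]
      add_diff_add)

text \<open>For \<open>h\<close> of weight zero, the Leibniz rule gives
  \<open>(\<delta>1 - w \<delta>2) (h a) = (\<delta>1 h) a + h (\<delta>1(a) - \<delta>2(a) w)\<close>, whose last term is \<open>h \<nabla>\<^sub>\<omega> a\<close> up to the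
  factor \<open>\<sigma>1\<close>. As \<open>\<sigma>1 (\<delta>1 - w \<delta>2)\<close> is linear, all presentations of a
  vector as a sum of such products lead to the same value.\<close>

lemma twisted_dirac_covariant:
  assumes w: "w \<in> base" and tw: "(\<psi>, \<xi>) \<in> twisted_dirac \<theta> (\<lambda>\<psi>. \<sigma>2 \<psi> + \<sigma>1 (lact \<theta> w \<psi>))"
  shows "\<psi> \<in> dom_dirac \<and> \<xi> = \<sigma>1 (covariant \<theta> w \<psi>)"
  using tw
proof induction
  case zero
  have "0 \<in> finite_support" by (simp add: finite_support_def)
  moreover have "covariant \<theta> w 0 = 0" unfolding covariant_def delta_linear mul_zero by (rule diff_zero)
  ultimately show ?case
    using subsetD[OF finite_support_dom_dirac] by (simp only: spin_linear simp_thms)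
next
  case (add \<psi> \<xi> h a k ts)
  have h: "h \<in> dom_dirac" and h0: "\<delta>2 h = 0"
    using add.hyps(2) by (auto simp: horizontal_dom_dirac hilb_weight_def scale_linear)
  have a: "a \<in> smooth" using add.hyps(3) by (simp add: alg_weight_def)
  note d = dom_diracD[OF h]
  note e = smooth_ell1[OF a]
  have dom: "rmul \<theta> a h \<in> dom_dirac" by (rule mul_dom_dirac(2)[OF a h])
  have "ract \<theta> a (horizontal dirac h) = \<sigma>1 (rmul \<theta> a (\<delta>1 h))"
    unfolding horizontal_dirac ract_rmul[OF e(1) hilb_pauli(1)[OF d(2)]] by (rule mul_linear(8)[OF e(1) d(2) d(2)])
  moreover have "right_form_op \<theta> ts h = \<sigma>1 (rmul \<theta> (der1 a) h - rmul \<theta> w (rmul \<theta> (der2 a) h))"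
    unfolding right_form_op_coeff[OF add.hyps(4) h] form_coeff_nabla[OF w a add.hyps(4,5)] nabla_coeff(3)[OF w a d(1)] ..
  moreover have "covariant \<theta> w (rmul \<theta> a h)
      = rmul \<theta> a (\<delta>1 h) + (rmul \<theta> (der1 a) h - rmul \<theta> w (rmul \<theta> (der2 a) h))"
    unfolding covariant_def Leibniz(3,4)[OF a d(1)] h0 mul_zero by (simp only: add_0_left add_diff_eq)
  ultimately have "ract \<theta> a (horizontal dirac h) + right_form_op \<theta> ts h = \<sigma>1 (covariant \<theta> w (rmul \<theta> a h))"
    by (simp only: spin_linear)
  moreover have "\<psi> + rmul \<theta> a h \<in> dom_dirac"
    using add.IH dom by (auto simp only: dom_dirac_def delta_linear mem_Collect_eq intro!: hilb_add)
  moreover have "covariant \<theta> w (\<psi> + rmul \<theta> a h) = covariant \<theta> w \<psi> + covariant \<theta> w (rmul \<theta> a h)"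
    using add.IH by (intro covariant_add[OF w _ dom]) simp
  ultimately show ?case
    using add.IH by (simp only: ract_rmul[OF e(1) d(1)] spin_linear simp_thms)
qed

lemma monomial_smooth: "monomial m n \<in> smooth"
  unfolding smooth_def
proof (intro CollectI allI)
  fix k
  show "\<exists>C. \<forall>p q. (1 + \<bar>real_of_int p\<bar> + \<bar>real_of_int q\<bar>) ^ k * cmod (monomial m n (p, q)) \<le> C"
    by (rule exI[of _ "(1 + \<bar>real_of_int m\<bar> + \<bar>real_of_int n\<bar>) ^ k"]) (simp add: monomial_def)
qed

lemma monomial_weight: "monomial m n \<in> alg_weight n"
  unfolding alg_weight_def by (simp add: monomial_smooth) (auto simp: der2_def monomial_def)

lemma rmul_monomial_unit: "rmul \<theta> (monomial 0 n) (unit_at (m, 0) v) = unit_at (m, n) v"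
proof
  fix x :: "int \<times> int"
  have "rmul \<theta> (monomial 0 n) (unit_at (m, 0) v) x
      = (\<Sum>\<^sub>\<infinity>y\<in>{(0, n)}. rker \<theta> (monomial 0 n) x y *s unit_at (m, 0) v (x - y))"
    unfolding rmul_def conv_def by (rule infsum_cong_neutral) (simp_all add: rker_def monomial_def)
  then show "rmul \<theta> (monomial 0 n) (unit_at (m, 0) v) x = unit_at (m, n) v x"
    by (cases x) (auto simp: rker_def monomial_def unit_at_def)
qed

text \<open>A vector at \<open>(m, n)\<close> is the product of the weight zero vector at \<open>(m, 0)\<close> with \<open>V\<^sup>n\<close>; no phase
  appears because the basis consists of the products \<open>U\<^sup>m V\<^sup>n\<close> in this order. The condition on \<open>\<nabla>\<^sub>\<omega>\<close> in the definition of a strong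
  connection provides the presentation of \<open>\<nabla>\<^sub>\<omega> (V\<^sup>n)\<close>.\<close>

lemma twisted_dirac_total:
  assumes \<omega>: "\<And>a. a \<in> smooth \<Longrightarrow> nabla \<theta> \<omega> a \<in> base_forms_alg \<theta>"
    and F: "finite F" and \<psi>: "\<And>x. x \<notin> F \<Longrightarrow> \<psi> x = 0"
  shows "\<exists>\<xi>. (\<psi>, \<xi>) \<in> twisted_dirac \<theta> \<omega>"
  using F \<psi>
proof (induction F arbitrary: \<psi>)
  case empty
  then have "\<psi> = 0" by (intro ext) simp
  then show ?case using twisted_dirac.zero[of \<theta> \<omega>] by (simp only:) (rule exI)
next
  case (insert x F)
  obtain m n where x: "x = (m, n)" by (cases x)
  define \<phi> where "\<phi> = \<psi>(x := 0)"
  have "\<exists>\<xi>. (\<phi>, \<xi>) \<in> twisted_dirac \<theta> \<omega>"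
    by (rule insert.IH) (use insert.prems in \<open>auto simp: \<phi>_def\<close>)
  then obtain \<xi> where \<xi>: "(\<phi>, \<xi>) \<in> twisted_dirac \<theta> \<omega>" ..
  let ?h = "unit_at (m, 0) (\<psi> x)"
  have hs: "?h \<in> hilb" "?h \<in> dom_dirac"
    using finite_support_hilb finite_support_dom_dirac by auto
  have h: "?h \<in> hilb_weight 0 \<inter> horizontal_dom dom_dirac"
    using hs by (simp add: hilb_weight_def delta_unit horizontal_dom_dirac)
  obtain ts where ts: "set ts \<subseteq> base \<times> base \<times> smooth" "eq_on_hilb (nabla \<theta> \<omega> (monomial 0 n)) (form_alg_op \<theta> ts)"
    using \<omega>[OF monomial_smooth] unfolding base_forms_alg_def by blast
  have "\<phi> + ract \<theta> (monomial 0 n) ?h = \<psi>"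
    unfolding ract_rmul[OF smooth_ell1(1)[OF monomial_smooth] hs(1)] rmul_monomial_unit x[symmetric]
    by (rule ext) (simp add: \<phi>_def unit_at_def)
  with twisted_dirac.add[OF \<xi> h monomial_weight ts] show ?case by (simp only:) (rule exI)
qed

theorem proposition6p5:
  fixes \<theta> :: real and \<omega>1 :: coeffs and \<omega> :: oper
  assumes "\<theta> \<notin> \<rat>"
    and "\<omega>1 \<in> base" and "star \<theta> \<omega>1 = \<omega>1"
    and "\<omega> = (\<lambda>\<psi>. \<sigma>2 \<psi> + \<sigma>1 (lact \<theta> \<omega>1 \<psi>))"
    and "selfadjoint_op hilb \<omega>" and "strong_connection \<theta> \<omega>"
  shows "compatible \<theta> \<omega> dom_dirac
    (\<lambda>\<psi>. dirac \<psi> - \<sigma>1 (j0 \<theta> (lact \<theta> \<omega>1 (inv (j0 \<theta>) (\<delta>2 \<psi>)))))"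
    (is "compatible \<theta> \<omega> dom_dirac ?D")
proof -
  note w = assms(2,3)
  have D: "?D \<psi> = twist \<theta> \<omega>1 \<psi>" if "\<psi> \<in> dom_dirac" for \<psi>
    by (rule dirac_minus_twist[OF w that])
  have hor: "horizontal ?D \<psi> = \<sigma>1 (covariant \<theta> \<omega>1 \<psi>)" if "\<psi> \<in> dom_dirac" for \<psi>
    by (rule horizontal_twist[OF w(1) that D])
  have spectral: "dirac_operator \<theta> dom_dirac ?D"
    unfolding dirac_operator_def
    by (intro conjI twist_selfadjoint[OF w D] twist_bounded_commutators[OF w(1) D] twist_compact_resolvent[OF w D])
  have base: "horizontal ?D h = horizontal dirac h" if "h \<in> hilb_weight 0 \<inter> horizontal_dom dom_dirac" for h
  proof -
    have h: "h \<in> dom_dirac" and h0: "\<delta>2 h = 0"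
      using that by (auto simp: horizontal_dom_dirac hilb_weight_def scale_linear)
    show ?thesis unfolding hor[OF h] horizontal_dirac covariant_def h0 mul_zero diff_zero ..
  qed
  have graph: "(\<psi>, \<xi>) \<in> twisted_dirac \<theta> \<omega> \<longleftrightarrow> \<xi> = horizontal ?D \<psi>" if \<psi>: "\<psi> \<in> finite_support" for \<psi> \<xi>
  proof -
    have unique: "\<xi> = horizontal ?D \<psi>" if "(\<psi>, \<xi>) \<in> twisted_dirac \<theta> \<omega>" for \<xi>
      unfolding hor[OF subsetD[OF finite_support_dom_dirac \<psi>]]
      by (rule conjunct2[OF twisted_dirac_covariant[OF w(1) that[unfolded assms(4)]]])
    have nabla: "nabla \<theta> \<omega> a \<in> base_forms_alg \<theta>" if "a \<in> smooth" for a
      using assms(6) that unfolding strong_connection_def by (elim conjE bspec)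
    have fin: "finite {x. \<psi> x \<noteq> 0}" using \<psi> by (simp only: finite_support_def mem_Collect_eq)
    have "\<exists>\<xi>. (\<psi>, \<xi>) \<in> twisted_dirac \<theta> \<omega>"
      by (rule twisted_dirac_total[OF nabla fin]) simp_all
    then obtain \<xi>' where \<xi>': "(\<psi>, \<xi>') \<in> twisted_dirac \<theta> \<omega>" ..
    show ?thesis
    proof
      assume "\<xi> = horizontal ?D \<psi>"
      then show "(\<psi>, \<xi>) \<in> twisted_dirac \<theta> \<omega>" using \<xi>' unfolding unique[OF \<xi>'] by (simp only:)
    qed (rule unique)
  qed
  show ?thesis
    unfolding compatible_def
  proof (intro conjI ballI exI[of _ finite_support] allI spectral base graph finite_support_dense refl)
    show "finite_support \<subseteq> horizontal_dom dom_dirac"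
      unfolding horizontal_dom_dirac by (rule finite_support_dom_dirac)
  qed
qed

end
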